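(* For every $n\geq1$ there is a consistent RE theory which is effectively inseparable but not $n$-Rosser. In particular, effective inseparability does not imply being Rosser.
   Context: $W_i$ denotes the RE set with index $i$. A disjoint pair $(A,B)$ of RE sets is effectively inseparable if there is a recursive $f(x,y)$ such that for all $i,j$, if $A\subseteq W_i$, $B\subseteq W_j$ and $W_i\cap W_j=\emptyset$ then $f(i,j)\notin W_i\cup W_j$. A theory $T$ is effectively inseparable if $(T_P,T_R)$ is, where $T_P$, $T_R$ are the sets of codes of sentences provable, resp. refutable, in $T$. ${\sf Num}$ is the theory in $\{\mathbf 0,\mathbf S\}$ with axioms $\overline m\neq\overline n$ for $m\neq n$, $\overline 0=\mathbf 0$, $\overline{k+1}=\mathbf S\overline k$. An interpretation $I:{\sf Num}\unlhd T$ is a translation of the language of ${\sf Num}$ into that of $T$ such that $T$ proves totality of translated function symbols on the domain, the translations of all theorems of ${\sf Num}$ and of the equality axioms (if $T$ is a relational extension of ${\sf Num}$, $I$ is taken to be the identity); $\overline a^I$ is the $I$-translation of $\overline a$. A formula $\phi(x_1,\dots,x_n)$ with exactly $n$ free variables strongly separates $M_1$ from $M_2$ in $T$ w.r.t. $I$ if $\vec a\in M_1\Rightarrow T\vdash\phi(\overline{a_1}^I,\dots,\overline{a_n}^I)$ and $\vec a\in M_2\Rightarrow T\vdash\neg\phi(\overline{a_1}^I,\dots,\overline{a_n}^I)$. A consistent RE theory $T$ is $n$-Rosser if there is $I$ such that for every pair of $n$-ary RE relations $M_1,M_2$ some formula strongly separates $M_1\setminus M_2$ from $M_2\setminus M_1$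 w.r.t. $I$; $T$ is Rosser if it is $n$-Rosser for every $n\ge1$. *)

theory Defs
  imports "HOL-Library.Nat_Bijection"
begin

section \<open>Recursive functions and RE sets\<close>

text \<open>
  Partial recursive functions on the natural numbers. Every function is unary; several arguments
  are passed through the pairing bijection \<^const>\<open>prod_encode\<close>.
\<close>

datatype recfn =
    ZeroF
  | SuccF
  | FstF
  | SndF
  | PairF recfn recfn
  | CompF recfn recfn
  | PrecF recfn recfn
  | MuF recfn

text \<open>\<open>ev p x y\<close>: the computation of \<open>p\<close> on input \<open>x\<close> halts with output \<open>y\<close>.\<close>

inductive ev :: "recfn \<Rightarrow> nat \<Rightarrow> nat \<Rightarrow> bool" where
  ev_Zero: "ev ZeroF x 0"
| ev_Succ: "ev SuccF x (Suc x)"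
| ev_Fst: "ev FstF x (fst (prod_decode x))"
| ev_Snd: "ev SndF x (snd (prod_decode x))"
| ev_Pair: "ev p x a \<Longrightarrow> ev q x b \<Longrightarrow> ev (PairF p q) x (prod_encode (a, b))"
| ev_Comp: "ev q x y \<Longrightarrow> ev p y z \<Longrightarrow> ev (CompF p q) x z"
| ev_Prec_0: "ev p a b \<Longrightarrow> ev (PrecF p q) (prod_encode (a, 0)) b"
| ev_Prec_Suc:
    "ev (PrecF p q) (prod_encode (a, k)) r \<Longrightarrow> ev q (prod_encode (a, prod_encode (k, r))) s
      \<Longrightarrow> ev (PrecF p q) (prod_encode (a, Suc k)) s"
| ev_Mu:
    "ev p (prod_encode (a, k)) 0 \<Longrightarrow> (\<forall>m<k. \<exists>r. ev p (prod_encode (a, m)) (Suc r))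
      \<Longrightarrow> ev (MuF p) a k"

primrec recfn_code :: "recfn \<Rightarrow> nat" where
  "recfn_code ZeroF = prod_encode (0, 0)"
| "recfn_code SuccF = prod_encode (1, 0)"
| "recfn_code FstF = prod_encode (2, 0)"
| "recfn_code SndF = prod_encode (3, 0)"
| "recfn_code (PairF p q) = prod_encode (4, prod_encode (recfn_code p, recfn_code q))"
| "recfn_code (CompF p q) = prod_encode (5, prod_encode (recfn_code p, recfn_code q))"
| "recfn_code (PrecF p q) = prod_encode (6, prod_encode (recfn_code p, recfn_code q))"
| "recfn_code (MuF p) = prod_encode (7, recfn_code p)"

text \<open>
  \<open>W i\<close> is the domain of the partial recursive function with index \<open>i\<close>. Numbers that do
  not code a program are indices of the nowhere defined function.
\<close>

definition W :: "nat \<Rightarrow> nat set" where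
  "W i = {x. \<exists>p y. recfn_code p = i \<and> ev p x y}"

definition re_set :: "nat set \<Rightarrow> bool" where
  "re_set A \<longleftrightarrow> (\<exists>i. A = W i)"

definition recursive :: "(nat \<Rightarrow> nat) \<Rightarrow> bool" where
  "recursive f \<longleftrightarrow> (\<exists>p. \<forall>x. ev p x (f x))"

definition recursive2 :: "(nat \<Rightarrow> nat \<Rightarrow> nat) \<Rightarrow> bool" where
  "recursive2 f \<longleftrightarrow> (\<exists>p. \<forall>x y. ev p (prod_encode (x, y)) (f x y))"

definition recursive_set :: "nat set \<Rightarrow> bool" where
  "recursive_set A \<longleftrightarrow> recursive (\<lambda>x. if x \<in> A then 1 else 0)"

definition re_relation :: "nat \<Rightarrow> nat list set \<Rightarrow> bool" where
  "re_relation n M \<longleftrightarrow> (\<forall>as\<in>M. length as = n) \<and> re_set (list_encode ` M)"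

definition effectively_inseparable :: "nat set \<Rightarrow> nat set \<Rightarrow> bool" where
  "effectively_inseparable A B \<longleftrightarrow>
     re_set A \<and> re_set B \<and> A \<inter> B = {} \<and>
     (\<exists>f. recursive2 f \<and>
        (\<forall>i j. A \<subseteq> W i \<longrightarrow> B \<subseteq> W j \<longrightarrow> W i \<inter> W j = {} \<longrightarrow> f i j \<notin> W i \<union> W j))"


section \<open>First-order logic with equality\<close>

text \<open>
  Variables are de Bruijn indices. Function and relation symbols are natural numbers; a signature
  consists of the pairs (symbol, arity) in use.
\<close>

datatype tm = Var nat | Fn nat "tm list"

datatype fm = Fls | Eq tm tm | Rel nat "tm list" | Imp fm fm | Forall fm

abbreviation Neg :: "fm \<Rightarrow> fm" where "Neg \<phi> \<equiv> Imp \<phi> Fls"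
abbreviation Conj :: "fm \<Rightarrow> fm \<Rightarrow> fm" where "Conj \<phi> \<psi> \<equiv> Neg (Imp \<phi> (Neg \<psi>))"
abbreviation Exists :: "fm \<Rightarrow> fm" where "Exists \<phi> \<equiv> Neg (Forall (Neg \<phi>))"

primrec subst_tm :: "(nat \<Rightarrow> tm) \<Rightarrow> tm \<Rightarrow> tm" where
  "subst_tm \<sigma> (Var x) = \<sigma> x"
| "subst_tm \<sigma> (Fn f ts) = Fn f (map (subst_tm \<sigma>) ts)"

definition lift_tm :: "tm \<Rightarrow> tm" where
  "lift_tm = subst_tm (\<lambda>x. Var (Suc x))"

primrec subst :: "(nat \<Rightarrow> tm) \<Rightarrow> fm \<Rightarrow> fm" where
  "subst \<sigma> Fls = Fls"
| "subst \<sigma> (Eq s t) = Eq (subst_tm \<sigma> s) (subst_tm \<sigma> t)"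
| "subst \<sigma> (Rel r ts) = Rel r (map (subst_tm \<sigma>) ts)"
| "subst \<sigma> (Imp \<phi> \<psi>) = Imp (subst \<sigma> \<phi>) (subst \<sigma> \<psi>)"
| "subst \<sigma> (Forall \<phi>) = Forall (subst (case_nat (Var 0) (\<lambda>x. lift_tm (\<sigma> x))) \<phi>)"

definition lift :: "fm \<Rightarrow> fm" where
  "lift = subst (\<lambda>x. Var (Suc x))"

text \<open>\<open>inst t \<phi>\<close> strips one binder: index 0 becomes \<open>t\<close>, the other free indices drop by one.\<close>

definition inst :: "tm \<Rightarrow> fm \<Rightarrow> fm" where
  "inst t = subst (case_nat t Var)"

fun fv_tm :: "tm \<Rightarrow> nat set" where
  "fv_tm (Var x) = {x}"
| "fv_tm (Fn f ts) = (\<Union>t\<in>set ts. fv_tm t)"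

primrec fv :: "fm \<Rightarrow> nat set" where
  "fv Fls = {}"
| "fv (Eq s t) = fv_tm s \<union> fv_tm t"
| "fv (Rel r ts) = (\<Union>t\<in>set ts. fv_tm t)"
| "fv (Imp \<phi> \<psi>) = fv \<phi> \<union> fv \<psi>"
| "fv (Forall \<phi>) = {x. Suc x \<in> fv \<phi>}"

record fo_theory =
  funs :: "(nat \<times> nat) set"
  rels :: "(nat \<times> nat) set"
  axs :: "fm set"

fun wf_tm :: "fo_theory \<Rightarrow> tm \<Rightarrow> bool" where
  "wf_tm T (Var x) \<longleftrightarrow> True"
| "wf_tm T (Fn f ts) \<longleftrightarrow> (f, length ts) \<in> funs T \<and> (\<forall>t\<in>set ts. wf_tm T t)"

primrec wf_fm :: "fo_theory \<Rightarrow> fm \<Rightarrow> bool" where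
  "wf_fm T Fls \<longleftrightarrow> True"
| "wf_fm T (Eq s t) \<longleftrightarrow> wf_tm T s \<and> wf_tm T t"
| "wf_fm T (Rel r ts) \<longleftrightarrow> (r, length ts) \<in> rels T \<and> (\<forall>t\<in>set ts. wf_tm T t)"
| "wf_fm T (Imp \<phi> \<psi>) \<longleftrightarrow> wf_fm T \<phi> \<and> wf_fm T \<psi>"
| "wf_fm T (Forall \<phi>) \<longleftrightarrow> wf_fm T \<phi>"

definition is_sentence :: "fo_theory \<Rightarrow> fm \<Rightarrow> bool" where
  "is_sentence T \<phi> \<longleftrightarrow> wf_fm T \<phi> \<and> fv \<phi> = {}"

text \<open>A Hilbert calculus for classical logic with equality, confined to the language of \<open>T\<close>.\<close>

inductive provable :: "fo_theory \<Rightarrow> fm \<Rightarrow> bool" for T where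
  Ax: "\<phi> \<in> axs T \<Longrightarrow> provable T \<phi>"
| Ax_K: "wf_fm T \<phi> \<Longrightarrow> wf_fm T \<psi> \<Longrightarrow> provable T (Imp \<phi> (Imp \<psi> \<phi>))"
| Ax_S: "wf_fm T \<phi> \<Longrightarrow> wf_fm T \<psi> \<Longrightarrow> wf_fm T \<chi> \<Longrightarrow>
    provable T (Imp (Imp \<phi> (Imp \<psi> \<chi>)) (Imp (Imp \<phi> \<psi>) (Imp \<phi> \<chi>)))"
| Ax_DN: "wf_fm T \<phi> \<Longrightarrow> provable T (Imp (Neg (Neg \<phi>)) \<phi>)"
| Ax_inst: "wf_fm T \<phi> \<Longrightarrow> wf_tm T t \<Longrightarrow> provable T (Imp (Forall \<phi>) (inst t \<phi>))"
| Ax_all: "wf_fm T \<phi> \<Longrightarrow> wf_fm T \<psi> \<Longrightarrow>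
    provable T (Imp (Forall (Imp (lift \<phi>) \<psi>)) (Imp \<phi> (Forall \<psi>)))"
| Ax_refl: "wf_tm T t \<Longrightarrow> provable T (Eq t t)"
| Ax_Leibniz: "wf_fm T \<phi> \<Longrightarrow> wf_tm T s \<Longrightarrow> wf_tm T t \<Longrightarrow>
    provable T (Imp (Eq s t) (Imp (inst s \<phi>) (inst t \<phi>)))"
| MP: "provable T (Imp \<phi> \<psi>) \<Longrightarrow> provable T \<phi> \<Longrightarrow> provable T \<psi>"
| Gen: "provable T \<phi> \<Longrightarrow> provable T (Forall \<phi>)"


section \<open>Codes, RE theories, effective inseparability\<close>

primrec tm_code :: "tm \<Rightarrow> nat" where
  "tm_code (Var x) = prod_encode (0, x)"
| "tm_code (Fn f ts) = prod_encode (1, prod_encode (f, list_encode (map tm_code ts)))"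

primrec fm_code :: "fm \<Rightarrow> nat" where
  "fm_code Fls = prod_encode (0, 0)"
| "fm_code (Eq s t) = prod_encode (1, prod_encode (tm_code s, tm_code t))"
| "fm_code (Rel r ts) = prod_encode (2, prod_encode (r, list_encode (map tm_code ts)))"
| "fm_code (Imp \<phi> \<psi>) = prod_encode (3, prod_encode (fm_code \<phi>, fm_code \<psi>))"
| "fm_code (Forall \<phi>) = prod_encode (4, fm_code \<phi>)"

definition re_theory :: "fo_theory \<Rightarrow> bool" where
  "re_theory T \<longleftrightarrow>
     recursive_set (prod_encode ` funs T) \<and> recursive_set (prod_encode ` rels T) \<and>
     (\<forall>\<phi>\<in>axs T. is_sentence T \<phi>) \<and> re_set (fm_code ` axs T)"

definition consistent :: "fo_theory \<Rightarrow> bool" where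
  "consistent T \<longleftrightarrow> \<not> provable T Fls"

definition provable_codes :: "fo_theory \<Rightarrow> nat set" where
  "provable_codes T = {fm_code \<phi> | \<phi>. is_sentence T \<phi> \<and> provable T \<phi>}"

definition refutable_codes :: "fo_theory \<Rightarrow> nat set" where
  "refutable_codes T = {fm_code \<phi> | \<phi>. is_sentence T \<phi> \<and> provable T (Neg \<phi>)}"

definition EI_theory :: "fo_theory \<Rightarrow> bool" where
  "EI_theory T \<longleftrightarrow> effectively_inseparable (provable_codes T) (refutable_codes T)"


section \<open>The theory Num and its interpretations\<close>

abbreviation Zero_tm :: tm where "Zero_tm \<equiv> Fn 0 []"
abbreviation Suc_tm :: "tm \<Rightarrow> tm" where "Suc_tm t \<equiv> Fn (Suc 0) [t]"

primrec numeral_tm :: "nat \<Rightarrow> tm" where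
  "numeral_tm 0 = Zero_tm"
| "numeral_tm (Suc k) = Suc_tm (numeral_tm k)"

definition Num :: fo_theory where
  "Num = \<lparr> funs = {(0, 0), (Suc 0, 1)}, rels = {},
     axs = {Neg (Eq (numeral_tm m) (numeral_tm n)) | m n. m \<noteq> n}
         \<union> {Eq (numeral_tm 0) Zero_tm}
         \<union> {Eq (numeral_tm (Suc k)) (Suc_tm (numeral_tm k)) | k. True} \<rparr>"

text \<open>
  One-dimensional, parameter-free relative translations of the language of Num. Index 0 is the
  argument of \<open>domI\<close> and the value in \<open>zeroI\<close>; in \<open>sucI\<close>, index 0 is the argument and index 1 the
  value.
\<close>

record num_translation =
  domI :: fm
  eqI :: fm
  zeroI :: fm
  sucI :: fm

definition translation_into :: "fo_theory \<Rightarrow> num_translation \<Rightarrow> bool" where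
  "translation_into T I \<longleftrightarrow>
     wf_fm T (domI I) \<and> fv (domI I) \<subseteq> {0} \<and>
     wf_fm T (eqI I) \<and> fv (eqI I) \<subseteq> {0, 1} \<and>
     wf_fm T (zeroI I) \<and> fv (zeroI I) \<subseteq> {0} \<and>
     wf_fm T (sucI I) \<and> fv (sucI I) \<subseteq> {0, 1}"

definition app1 :: "fm \<Rightarrow> nat \<Rightarrow> fm" where
  "app1 \<phi> x = subst (\<lambda>_. Var x) \<phi>"

definition app2 :: "fm \<Rightarrow> nat \<Rightarrow> nat \<Rightarrow> fm" where
  "app2 \<phi> x y = subst (case_nat (Var x) (\<lambda>_. Var y)) \<phi>"

text \<open>
  \<open>value_tr I d t y\<close> is the translation of \<open>t = y\<close>, where nested terms are unravelled with new
  existentially quantified variables relativised to the domain; \<open>d\<close> counts the quantifiers passed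
  so far, by which the variables of \<open>t\<close> have to be shifted. The last equation concerns only terms
  outside the language of Num.
\<close>

fun value_tr :: "num_translation \<Rightarrow> nat \<Rightarrow> tm \<Rightarrow> nat \<Rightarrow> fm" where
  "value_tr I d (Var x) y = app2 (eqI I) (x + d) y"
| "value_tr I d Zero_tm y = app1 (zeroI I) y"
| "value_tr I d (Suc_tm (Var x)) y = app2 (sucI I) (x + d) y"
| "value_tr I d (Suc_tm (Fn f ts)) y =
     Exists (Conj (app1 (domI I) 0)
          (Conj (value_tr I (Suc d) (Fn f ts) 0) (app2 (sucI I) 0 (Suc y))))"
| "value_tr I d _ y = Fls"

fun translate :: "num_translation \<Rightarrow> fm \<Rightarrow> fm" where
  "translate I Fls = Fls"
| "translate I (Eq s (Var y)) = value_tr I 0 s y"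
| "translate I (Eq s (Fn f ts)) =
     Exists (Conj (app1 (domI I) 0) (Conj (value_tr I 1 s 0) (value_tr I 1 (Fn f ts) 0)))"
| "translate I (Rel r ts) = Fls"
| "translate I (Imp \<phi> \<psi>) = Imp (translate I \<phi>) (translate I \<psi>)"
| "translate I (Forall \<phi>) = Forall (Imp (app1 (domI I) 0) (translate I \<phi>))"

definition identity_translation :: num_translation where
  "identity_translation =
     \<lparr> domI = Eq (Var 0) (Var 0), eqI = Eq (Var 0) (Var 1),
       zeroI = Eq Zero_tm (Var 0), sucI = Eq (Suc_tm (Var 0)) (Var 1) \<rparr>"

definition relational_extension_of_Num :: "fo_theory \<Rightarrow> bool" where
  "relational_extension_of_Num T \<longleftrightarrow> funs T = funs Num \<and> (\<forall>\<phi>\<in>axs Num. provable T \<phi>)"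

text \<open>
  The equality axioms for the language of Num are theorems of Num, so that their translations need
  not be mentioned separately.
\<close>

definition interpretation_of_Num :: "fo_theory \<Rightarrow> num_translation \<Rightarrow> bool" where
  "interpretation_of_Num T I \<longleftrightarrow>
     translation_into T I \<and>
     provable T (Exists (Conj (app1 (domI I) 0) (app1 (zeroI I) 0))) \<and>
     provable T (Forall (Imp (app1 (domI I) 0)
                  (Exists (Conj (app1 (domI I) 0) (app2 (sucI I) 1 0))))) \<and>
     (\<forall>\<phi>. is_sentence Num \<phi> \<longrightarrow> provable Num \<phi> \<longrightarrow> provable T (translate I \<phi>)) \<and>
     (relational_extension_of_Num T \<longrightarrow> I = identity_translation)"


section \<open>Strong separation and Rosser theories\<close>

text \<open>
  \<open>apply_numerals I \<phi> [a\<^sub>1, \<dots>, a\<^sub>n]\<close> is \<open>\<phi>\<close> applied to the translated numerals. Since \<open>I\<close>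
  translates function symbols into formulas, a translated numeral is eliminated like every other
  term: \<open>\<exists>x\<^sub>1 \<dots> x\<^sub>n\<close> in the domain such that \<open>x\<^sub>i\<close> is a value of the \<open>i\<close>-th numeral and
  \<open>\<phi>(x\<^sub>1, \<dots>, x\<^sub>n)\<close>. The variable \<open>x\<^sub>i\<close> is the de Bruijn index \<open>i - 1\<close>.
\<close>

definition apply_numerals :: "num_translation \<Rightarrow> fm \<Rightarrow> nat list \<Rightarrow> fm" where
  "apply_numerals I \<phi> as =
     (Exists ^^ length as)
       (foldr (\<lambda>i. Conj (Conj (app1 (domI I) i) (value_tr I 0 (numeral_tm (as ! i)) i)))
          [0..<length as] \<phi>)"

definition strongly_separates ::
  "fo_theory \<Rightarrow> num_translation \<Rightarrow> nat \<Rightarrow> fm \<Rightarrow> nat list set \<Rightarrow> nat list set \<Rightarrow> bool" where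
  "strongly_separates T I n \<phi> M\<^sub>1 M\<^sub>2 \<longleftrightarrow>
     wf_fm T \<phi> \<and> fv \<phi> = {..<n} \<and>
     (\<forall>as\<in>M\<^sub>1. provable T (apply_numerals I \<phi> as)) \<and>
     (\<forall>as\<in>M\<^sub>2. provable T (Neg (apply_numerals I \<phi> as)))"

definition n_Rosser :: "nat \<Rightarrow> fo_theory \<Rightarrow> bool" where
  "n_Rosser n T \<longleftrightarrow>
     (\<exists>I. interpretation_of_Num T I \<and>
        (\<forall>M\<^sub>1 M\<^sub>2. re_relation n M\<^sub>1 \<longrightarrow> re_relation n M\<^sub>2 \<longrightarrow>
           (\<exists>\<phi>. strongly_separates T I n \<phi> (M\<^sub>1 - M\<^sub>2) (M\<^sub>2 - M\<^sub>1))))"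

definition Rosser :: "fo_theory \<Rightarrow> bool" where
  "Rosser T \<longleftrightarrow> (\<forall>n\<ge>1. n_Rosser n T)"

end

theory Submission
  imports Defs
begin

text \<open>
  A theory whose only nonlogical symbols are propositional letters \<open>P\<^sub>n\<close> and whose axioms are
  literals, consistent with each other, has a one-element model. In such a model all numerals of an
  interpretation of Num would have the same value, so Num is not interpretable and the theory is not
  \<open>n\<close>-Rosser for any \<open>n\<close>. It can nevertheless be effectively inseparable: for \<open>n = (i, j)\<close>, watch
  the enumerations of \<open>W i\<close> and \<open>W j\<close>, and add the axiom \<open>\<not> P\<^sub>n\<close> if the code of \<open>P\<^sub>n\<close> enters \<open>W i\<close>
  first, and \<open>P\<^sub>n\<close> if it enters \<open>W j\<close> first. Then the code of \<open>P\<^sub>n\<close> is outside \<open>W i \<union> W j\<close> whenever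
  \<open>W i\<close> and \<open>W j\<close> are disjoint and contain the codes of the provable and of the refutable sentences.

  The universal RE relation and the set of provable sentences are RE because both are least models
  of Horn programs over the natural numbers with pairing, and such a model is RE: derivations can be
  coded and checked.
\<close>

subsection \<open>Recursive functions and decidable sets\<close>

lemma recursive_const [intro]: "recursive (\<lambda>_. c)"
proof (induction c)
  case 0
  show ?case unfolding recursive_def by (blast intro: ev_Zero)
next
  case (Suc c)
  then obtain p where "\<forall>x. ev p x c" unfolding recursive_def by blast
  then have "\<forall>x. ev (CompF SuccF p) x (Suc c)" by (blast intro: ev_Comp ev_Succ)
  then show ?case unfolding recursive_def by blast
qed

lemma recursive_comp: "recursive f \<Longrightarrow> recursive g \<Longrightarrow> recursive (\<lambda>x. f (g x))"
  unfolding recursive_def by (meson ev_Comp)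

lemma recursive_pair [intro]:
  "recursive f \<Longrightarrow> recursive g \<Longrightarrow> recursive (\<lambda>x. prod_encode (f x, g x))"
  unfolding recursive_def by (meson ev_Pair)

lemma recursive_Suc [intro]: "recursive f \<Longrightarrow> recursive (\<lambda>x. Suc (f x))"
  unfolding recursive_def by (meson ev_Comp ev_Succ)

lemma recursive_fst [intro]: "recursive f \<Longrightarrow> recursive (\<lambda>x. fst (prod_decode (f x)))"
  unfolding recursive_def by (meson ev_Comp ev_Fst)

lemma recursive_snd [intro]: "recursive f \<Longrightarrow> recursive (\<lambda>x. snd (prod_decode (f x)))"
  unfolding recursive_def by (meson ev_Comp ev_Snd)

lemma recursive_id [intro]: "recursive (\<lambda>x. x)"
proof -
  have "ev (PairF FstF SndF) x x" for x
    using ev_Pair[OF ev_Fst ev_Snd, of x] by simp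
  then show ?thesis unfolding recursive_def by blast
qed

text \<open>\<open>PrecF\<close> hands its step program the parameter, the counter and the previous
  value as nested pairs, which is the form of the third assumption. Composing with the map from
  \<open>x\<close> to \<open>prod_encode (x, n x)\<close> makes the whole input the parameter, so
  that \<open>a\<close>, \<open>g\<close> and \<open>n\<close> may all depend on it.\<close>

lemma recursive_rec_nat:
  assumes "recursive a" "recursive n"
    and "recursive (\<lambda>y. g (fst (prod_decode y)) (fst (prod_decode (snd (prod_decode y))))
                          (snd (prod_decode (snd (prod_decode y)))))"
  shows "recursive (\<lambda>x. rec_nat (a x) (g x) (n x))"
proof -
  obtain p where p: "\<And>x. ev p x (a x)" using assms(1) unfolding recursive_def by blast
  obtain q where q: "\<And>x. ev q x (g (fst (prod_decode x)) (fst (prod_decode (snd (prod_decode x))))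
      (snd (prod_decode (snd (prod_decode x)))))"
    using assms(3) unfolding recursive_def by blast
  have "ev (PrecF p q) (prod_encode (x, k)) (rec_nat (a x) (g x) k)" for x k
  proof (induction k)
    case 0
    show ?case by (auto intro: ev_Prec_0 p)
  next
    case (Suc k)
    show ?case
      using ev_Prec_Suc[OF Suc q] by simp
  qed
  then have "recursive (\<lambda>y. rec_nat (a (fst (prod_decode y))) (g (fst (prod_decode y)))
      (snd (prod_decode y)))"
    unfolding recursive_def by (metis prod.collapse prod_decode_inverse)
  then have "recursive (\<lambda>x. rec_nat (a (fst (prod_decode (prod_encode (x, n x)))))
      (g (fst (prod_decode (prod_encode (x, n x))))) (snd (prod_decode (prod_encode (x, n x)))))"
    by (rule recursive_comp[where g = "\<lambda>x. prod_encode (x, n x)"])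
      (intro recursive_pair recursive_id assms)
  then show ?thesis by simp
qed

lemma recursive_pred [intro]:
  assumes "recursive f"
  shows "recursive (\<lambda>x. f x - 1)"
proof -
  have "k - 1 = rec_nat 0 (\<lambda>k _. k) k" for k :: nat by (cases k) auto
  moreover have "recursive (\<lambda>x. rec_nat 0 (\<lambda>k _. k) (f x))"
    by (rule recursive_rec_nat[where g = "\<lambda>_ k _. k"]) (intro recursive_const assms recursive_fst recursive_snd recursive_id)+
  ultimately show ?thesis by simp
qed

lemma recursive_diff:
  assumes "recursive f" "recursive g"
  shows "recursive (\<lambda>x. f x - g x)"
proof -
  have "m - k = rec_nat m (\<lambda>_ r. r - 1) k" for m k :: nat
    by (induction k) auto
  then have eq: "(\<lambda>x. f x - g x) = (\<lambda>x. rec_nat (f x) (\<lambda>_ r. r - 1) (g x))" by blast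
  have "recursive (\<lambda>x. rec_nat (f x) (\<lambda>_ r. r - 1) (g x))"
    by (rule recursive_rec_nat[where g = "\<lambda>_ _ r. r - 1"]) (intro recursive_pred assms recursive_snd recursive_id)+
  then show ?thesis unfolding eq .
qed

lemma recursive_if_zero:
  assumes "recursive n" "recursive a" "recursive b"
  shows "recursive (\<lambda>x. if n x = 0 then a x else b x)"
proof -
  have "(if n x = 0 then a x else b x) = rec_nat (a x) (\<lambda>_ _. b x) (n x)" for x
    by (cases "n x") auto
  moreover have "recursive (\<lambda>x. rec_nat (a x) (\<lambda>_ _. b x) (n x))"
    by (rule recursive_rec_nat[where g = "\<lambda>x _ _. b x"])
      (use assms recursive_comp[of b, OF _ recursive_fst[OF recursive_id]] in auto)
  ultimately show ?thesis by simp
qed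

lemma recursive_set_vimage: "recursive_set R \<Longrightarrow> recursive f \<Longrightarrow> recursive_set {x. f x \<in> R}"
  using recursive_comp[of "\<lambda>x. if x \<in> R then 1 else 0" f] unfolding recursive_set_def by simp

lemma recursive_set_eq_0:
  assumes "recursive f"
  shows "recursive_set {x. f x = 0}"
  using recursive_if_zero[OF assms recursive_const[of 1] recursive_const[of 0]]
  unfolding recursive_set_def by simp

lemma recursive_set_Not:
  assumes "recursive_set {x. Q x}"
  shows "recursive_set {x. \<not> Q x}"
proof -
  have "recursive_set {x. (if Q x then 1 else 0 :: nat) = 0}"
    using assms by (intro recursive_set_eq_0) (simp add: recursive_set_def)
  moreover have "{x. (if Q x then 1 else 0 :: nat) = 0} = {x. \<not> Q x}" by auto
  ultimately show ?thesis by simp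
qed

lemma recursive_set_conj:
  assumes "recursive_set {x. Q x}" "recursive_set {x. R x}"
  shows "recursive_set {x. Q x \<and> R x}"
proof -
  have "recursive (\<lambda>x. if (if Q x then 1 else 0 :: nat) = 0 then 0 else (if R x then 1 else 0 :: nat))"
    using assms by (intro recursive_if_zero recursive_const) (simp_all add: recursive_set_def)
  moreover have "(if (if Q x then 1 else 0 :: nat) = 0 then 0 else (if R x then 1 else 0 :: nat))
     = (if x \<in> {x. Q x \<and> R x} then 1 else 0)" for x by simp
  ultimately show ?thesis unfolding recursive_set_def by (simp only:)
qed

lemma recursive_set_disj:
  assumes "recursive_set {x. Q x}" "recursive_set {x. R x}"
  shows "recursive_set {x. Q x \<or> R x}"
  using recursive_set_Not[OF recursive_set_conj[OF assms[THEN recursive_set_Not]]] by simp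

lemma recursive_set_eq:
  assumes "recursive f" "recursive g"
  shows "recursive_set {x. f x = g x}"
proof -
  have "recursive_set {x. f x - g x = 0 \<and> g x - f x = 0}"
    by (intro recursive_set_conj recursive_set_eq_0 recursive_diff assms)
  moreover have "{x. f x - g x = 0 \<and> g x - f x = 0} = {x. f x = g x}" by auto
  ultimately show ?thesis by simp
qed

lemma recursive_set_bex_less:
  assumes "recursive n" and Q: "recursive_set {y. Q (fst (prod_decode y)) (snd (prod_decode y))}"
  shows "recursive_set {x. \<exists>k<n x. Q x k}"
proof -
  \<comment> \<open>The accumulator \<open>r\<close> is a flag that stays 1 once a witness has been
    met.\<close>
  define g where "g x k r = (if r = 0 then if Q x k then 1 else 0 else 1 :: nat)" for x k r :: nat
  have "rec_nat 0 (g x) m = (if \<exists>k<m. Q x k then 1 else 0)" for x m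
    by (induction m) (auto simp: g_def less_Suc_eq)
  moreover have "recursive (\<lambda>x. rec_nat 0 (g x) (n x))"
  proof (rule recursive_rec_nat[OF recursive_const assms(1)])
    have "recursive (\<lambda>y. if Q (fst (prod_decode y)) (snd (prod_decode y)) then 1 else 0)"
      using Q by (simp add: recursive_set_def)
    from recursive_comp[OF this, of "\<lambda>y. prod_encode (fst (prod_decode y), fst (prod_decode (snd (prod_decode y))))"]
    have "recursive (\<lambda>y. if Q (fst (prod_decode y)) (fst (prod_decode (snd (prod_decode y)))) then 1 else 0)"
      by (simp add: recursive_pair recursive_fst recursive_snd recursive_id)
    then show "recursive (\<lambda>y. g (fst (prod_decode y)) (fst (prod_decode (snd (prod_decode y))))
                   (snd (prod_decode (snd (prod_decode y)))))"
      unfolding g_def by (intro recursive_if_zero recursive_const recursive_snd recursive_id)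
  qed
  ultimately show ?thesis unfolding recursive_set_def by simp
qed

lemma recursive_set_ball_less:
  assumes "recursive n" and "recursive_set {y. Q (fst (prod_decode y)) (snd (prod_decode y))}"
  shows "recursive_set {x. \<forall>k<n x. Q x k}"
  using recursive_set_Not[OF recursive_set_bex_less[OF assms(1) recursive_set_Not[OF assms(2)]]]
  by simp

lemma recursive_set_const: "recursive_set {x. Q}"
  unfolding recursive_set_def by (cases Q) (simp_all add: recursive_const)

lemma recursive_set_Bex_list:
  "(\<And>a. a \<in> set as \<Longrightarrow> recursive_set {x. Q x a}) \<Longrightarrow> recursive_set {x. \<exists>a\<in>set as. Q x a}"
  using recursive_set_const[of False]
  by (induction as) (simp_all add: recursive_set_disj)

lemma recursive_set_Ball_list:
  "(\<And>a. a \<in> set as \<Longrightarrow> recursive_set {x. Q x a}) \<Longrightarrow> recursive_set {x. \<forall>a\<in>set as. Q x a}"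
  using recursive_set_const[of True]
  by (induction as) (simp_all add: recursive_set_conj)

lemma recursive_funpow:
  assumes "recursive f" "recursive n" "recursive a"
  shows "recursive (\<lambda>x. (f ^^ n x) (a x))"
proof -
  have "(f ^^ k) z = rec_nat z (\<lambda>_. f) k" for k z by (induction k) auto
  moreover have "recursive (\<lambda>x. rec_nat (a x) (\<lambda>_. f) (n x))"
    by (rule recursive_rec_nat[where g = "\<lambda>_ _. f"])
      (intro assms recursive_comp[OF assms(1)] recursive_snd recursive_id)+
  ultimately show ?thesis by simp
qed


subsection \<open>Semidecidable sets\<close>

text \<open>The projection form makes closure under unions and preimages a matter of combining
  decidable witness relations, without interleaving computations. It is turned into an index only at
  the very end, by unbounded search for a witness.\<close>

definition semidecidable :: "nat set \<Rightarrow> bool" where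
  "semidecidable S \<longleftrightarrow> (\<exists>R. recursive_set R \<and> (\<forall>x. x \<in> S \<longleftrightarrow> (\<exists>d. prod_encode (x, d) \<in> R)))"

section \<open>Injectivity of program codes and single-valuedness of computations\<close>

lemma recfn_code_inject [simp]: "recfn_code p = recfn_code q \<longleftrightarrow> p = q"
proof
  show "recfn_code p = recfn_code q \<Longrightarrow> p = q"
  proof (induction p arbitrary: q)
    case ZeroF then show ?case by (cases q) auto
  next
    case SuccF then show ?case by (cases q) auto
  next
    case FstF then show ?case by (cases q) auto
  next
    case SndF then show ?case by (cases q) auto
  next
    case PairF then show ?case by (cases q) auto
  next
    case CompF then show ?case by (cases q) auto
  next
    case PrecF then show ?case by (cases q) auto
  next
    case MuF then show ?case by (cases q) auto
  qed
qed auto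

inductive_cases ev_ZeroE: "ev ZeroF x y"
inductive_cases ev_SuccE: "ev SuccF x y"
inductive_cases ev_FstE: "ev FstF x y"
inductive_cases ev_SndE: "ev SndF x y"
inductive_cases ev_PairE: "ev (PairF p q) x y"
inductive_cases ev_CompE: "ev (CompF p q) x y"
inductive_cases ev_PrecE: "ev (PrecF p q) x y"
inductive_cases ev_MuE: "ev (MuF p) x y"

text \<open>As \<open>ev\<close> is only a relation, uniqueness of outputs needs a proof. It is what
  makes \<open>ev p x 0\<close> decide membership when \<open>p\<close> computes a characteristic
  function.\<close>

lemma ev_deterministic: "ev p x y \<Longrightarrow> ev p x z \<Longrightarrow> y = z"
proof (induction arbitrary: z rule: ev.induct)
  case (ev_Mu p a k)
  from ev_Mu.prems obtain
    z: "ev p (prod_encode (a, z)) 0" "\<forall>m<z. \<exists>r. ev p (prod_encode (a, m)) (Suc r)"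
    by (auto elim: ev_MuE)
  \<comment> \<open>If one search result were smaller than the other, the program would have both 0
    and a successor as outputs there.\<close>
  have "\<not> k < z" using z(2) ev_Mu.IH(1) by (metis nat.distinct(1))
  moreover have "\<not> z < k" using z(1) ev_Mu.IH(2) by (metis nat.distinct(1))
  ultimately show ?case by (meson linorder_neqE_nat)
next
  case (ev_Pair p x a q b)
  from ev_Pair.prems show ?case
    by (rule ev_PairE) (metis ev_Pair.IH)
next
  case (ev_Comp q x y p w)
  from ev_Comp.prems show ?case
    by (rule ev_CompE) (metis ev_Comp.IH)
next
  case (ev_Prec_0 p a b q)
  from ev_Prec_0.prems show ?case
    by (rule ev_PrecE) (metis ev_Prec_0.IH Pair_inject prod_encode_eq nat.distinct(1))+
next
  case (ev_Prec_Suc p q a k r s)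
  from ev_Prec_Suc.prems show ?case
    by (rule ev_PrecE) (metis ev_Prec_Suc.IH Pair_inject prod_encode_eq nat.distinct(1) nat.inject)+
qed (auto elim: ev_ZeroE ev_SuccE ev_FstE ev_SndE)

lemma W_recfn_code: "W (recfn_code p) = {x. \<exists>y. ev p x y}"
  unfolding W_def by auto

lemma semidecidable_imp_re_set:
  assumes "semidecidable S"
  shows "re_set S"
proof -
  obtain R where R: "recursive_set R" "\<And>x. x \<in> S \<longleftrightarrow> (\<exists>d. prod_encode (x, d) \<in> R)"
    using assms unfolding semidecidable_def by blast
  \<comment> \<open>\<open>MuF\<close> searches for the output 0 and requires all earlier outputs to
    be defined and positive. Hence the total characteristic function is taken with its two values
    swapped.\<close>
  have "recursive_set {x. \<not> x \<in> R}"
    by (rule recursive_set_Not) (use R(1) in simp)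
  moreover have "(if x \<in> {x. x \<notin> R} then 1 else 0) = (if x \<in> R then 0 else 1 :: nat)" for x by simp
  ultimately have "recursive (\<lambda>x. if x \<in> R then 0 else 1)"
    unfolding recursive_set_def by (simp only:)
  then obtain p where p: "\<And>x. ev p x (if x \<in> R then 0 else 1)"
    unfolding recursive_def by blast
  have p0: "ev p x 0 \<longleftrightarrow> x \<in> R" for x
    using ev_deterministic[OF p[of x], of 0] p[of x] by (auto split: if_splits)
  have pS: "\<exists>r. ev p x (Suc r)" if "x \<notin> R" for x
    using p[of x] that by (metis One_nat_def)
  have "x \<in> S \<longleftrightarrow> (\<exists>y. ev (MuF p) x y)" for x
  proof
    assume "x \<in> S"
    then obtain d where d: "prod_encode (x, d) \<in> R" using R by blast
    define k where "k = (LEAST d. prod_encode (x, d) \<in> R)"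
    have "prod_encode (x, k) \<in> R" unfolding k_def by (rule LeastI[of _ d]) (rule d)
    moreover have "\<forall>m<k. prod_encode (x, m) \<notin> R" unfolding k_def by (blast dest: not_less_Least)
    ultimately show "\<exists>y. ev (MuF p) x y" by (meson ev_Mu p0 pS)
  next
    assume "\<exists>y. ev (MuF p) x y"
    then show "x \<in> S" using R(2) p0 by (blast elim: ev_MuE)
  qed
  then have "S = W (recfn_code (MuF p))" unfolding W_recfn_code by auto
  then show ?thesis unfolding re_set_def by blast
qed

lemma semidecidable_vimage:
  assumes "semidecidable S" "recursive f"
  shows "semidecidable {x. f x \<in> S}"
proof -
  obtain R where R: "recursive_set R" "\<And>x. x \<in> S \<longleftrightarrow> (\<exists>d. prod_encode (x, d) \<in> R)"
    using assms unfolding semidecidable_def by blast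
  let ?R = "{y. prod_encode (f (fst (prod_decode y)), snd (prod_decode y)) \<in> R}"
  have "recursive_set ?R"
    by (intro recursive_set_vimage R(1) recursive_pair recursive_comp[OF assms(2)] recursive_fst
        recursive_snd recursive_id)
  then show ?thesis
    unfolding semidecidable_def by (intro exI[of _ ?R]) (simp add: R(2))
qed

lemma semidecidable_empty: "semidecidable {}"
  unfolding semidecidable_def using recursive_set_const[of False] by auto

lemma semidecidable_Un:
  assumes "semidecidable A" "semidecidable B"
  shows "semidecidable (A \<union> B)"
proof -
  obtain R S where R: "recursive_set R" "\<And>x. x \<in> A \<longleftrightarrow> (\<exists>d. prod_encode (x, d) \<in> R)"
    and S: "recursive_set S" "\<And>x. x \<in> B \<longleftrightarrow> (\<exists>d. prod_encode (x, d) \<in> S)"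
    using assms unfolding semidecidable_def by blast
  have "recursive_set {y. y \<in> R \<or> y \<in> S}"
    by (intro recursive_set_disj) (simp_all add: R S)
  then show ?thesis
    unfolding semidecidable_def by (intro exI[of _ "{y. y \<in> R \<or> y \<in> S}"]) (auto simp: R S)
qed

text \<open>Meant for base sets of Horn programs, where a first component tells apart the members of
  several sets.\<close>

lemma semidecidable_tagged:
  assumes "semidecidable A"
  shows "semidecidable {prod_encode (t, n) | n. n \<in> A}"
proof -
  obtain R where R: "recursive_set R" "\<And>x. x \<in> A \<longleftrightarrow> (\<exists>d. prod_encode (x, d) \<in> R)"
    using assms unfolding semidecidable_def by blast
  let ?R = "{y. fst (prod_decode (fst (prod_decode y))) = t
    \<and> prod_encode (snd (prod_decode (fst (prod_decode y))), snd (prod_decode y)) \<in> R}"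
  have "recursive_set ?R"
    by (intro recursive_set_conj recursive_set_eq recursive_set_vimage[OF R(1)] recursive_pair
        recursive_fst recursive_snd recursive_const recursive_id)
  moreover have "(x \<in> {prod_encode (t, n) | n. n \<in> A}) \<longleftrightarrow> (\<exists>d. prod_encode (x, d) \<in> ?R)" for x
  proof -
    obtain u n where "x = prod_encode (u, n)" by (metis prod.collapse prod_decode_inverse)
    then show ?thesis by (auto simp: R(2))
  qed
  ultimately show ?thesis unfolding semidecidable_def by blast
qed


subsection \<open>Horn programs\<close>

datatype pat = PVar nat | PConst nat | PSuc pat | PPair pat pat

primrec pat_value :: "(nat \<Rightarrow> nat) \<Rightarrow> pat \<Rightarrow> nat" where
  "pat_value e (PVar i) = e i"
| "pat_value e (PConst n) = n"
| "pat_value e (PSuc p) = Suc (pat_value e p)"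
| "pat_value e (PPair p q) = prod_encode (pat_value e p, pat_value e q)"

primrec pat_vars :: "pat \<Rightarrow> nat set" where
  "pat_vars (PVar i) = {i}"
| "pat_vars (PConst n) = {}"
| "pat_vars (PSuc p) = pat_vars p"
| "pat_vars (PPair p q) = pat_vars p \<union> pat_vars q"

type_synonym clause = "pat list \<times> pat"

text \<open>One set of numbers models several predicates at once: the first component of a number
  names the predicate, the rest holds its arguments. The base set \<open>B\<close> supplies facts
  from outside, later the membership facts of the two sets of axioms.\<close>

inductive derives :: "clause list \<Rightarrow> nat set \<Rightarrow> nat \<Rightarrow> bool" for P B where
  base: "x \<in> B \<Longrightarrow> derives P B x"
| clause: "(ps, c) \<in> set P \<Longrightarrow> (\<And>p. p \<in> set ps \<Longrightarrow> derives P B (pat_value e p)) \<Longrightarrow>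
    derives P B (pat_value e c)"

text \<open>The derivable numbers are the least model containing the base set, so any model
  \<open>M\<close> bounds them. Soundness of both programs below is thereby reduced to a check of
  each clause.\<close>

lemma derives_sound:
  assumes "derives P B x" "\<And>x. x \<in> B \<Longrightarrow> M x"
    and "\<forall>(ps, c)\<in>set P. \<forall>e. (\<forall>p\<in>set ps. M (pat_value e p)) \<longrightarrow> M (pat_value e c)"
  shows "M x"
  using assms(1)
proof (induction rule: derives.induct)
  case (clause ps c e)
  then show ?case using assms(3) by fast
qed (rule assms(2))

section \<open>Environments coded as numbers\<close>

lemma pat_value_cong: "(\<And>i. i \<in> pat_vars p \<Longrightarrow> e i = e' i) \<Longrightarrow> pat_value e p = pat_value e' p"
  by (induction p) auto

lemma finite_pat_vars: "finite (pat_vars p)"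
  by (induction p) auto

text \<open>The number \<open>w\<close> is read as an infinite stream by iterated unpairing, so
  every number is an environment and no length has to be stored.\<close>

definition env :: "nat \<Rightarrow> nat \<Rightarrow> nat" where
  "env w i = fst (prod_decode (((\<lambda>v. snd (prod_decode v)) ^^ i) w))"

lemma ex_env: "\<exists>w. \<forall>i<n. env w i = e i"
proof (induction n arbitrary: e)
  case (Suc n)
  obtain w where w: "\<forall>i<n. env w i = e (Suc i)" using Suc[of "\<lambda>i. e (Suc i)"] by blast
  have "env (prod_encode (e 0, w)) i = e i" if "i < Suc n" for i
    using that w by (cases i) (auto simp: env_def funpow_Suc_right simp del: funpow.simps)
  then show ?case by blast
qed simp

text \<open>A clause has finitely many variables, so one number can code all the values that matter.
  This number is the witness that a derivation stores for the application of the clause.\<close>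

lemma ex_env_clause: "\<exists>w. \<forall>p\<in>set (c # ps). pat_value (env w) p = pat_value e p"
proof -
  have "finite (\<Union>p\<in>set (c # ps). pat_vars p)" by (simp add: finite_pat_vars)
  then obtain n where n: "\<forall>i\<in>(\<Union>p\<in>set (c # ps). pat_vars p). i < n"
    using finite_nat_set_iff_bounded by blast
  obtain w where "\<forall>i<n. env w i = e i" using ex_env by blast
  then have "pat_value (env w) p = pat_value e p" if "p \<in> set (c # ps)" for p
    using n that by (intro pat_value_cong) (meson UN_I)
  then show ?thesis by blast
qed

lemma recursive_env:
  assumes "recursive f"
  shows "recursive (\<lambda>x. env (f x) i)"
  unfolding env_def
  by (intro recursive_fst recursive_funpow recursive_snd recursive_id recursive_const assms)

lemma recursive_pat_value:
  assumes "recursive f"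
  shows "recursive (\<lambda>x. pat_value (env (f x)) p)"
  by (induction p) (simp_all add: recursive_env[OF assms] recursive_const recursive_Suc recursive_pair)

section \<open>List operations on codes\<close>

definition code_hd :: "nat \<Rightarrow> nat" where "code_hd l = fst (prod_decode (l - 1))"
definition code_tl :: "nat \<Rightarrow> nat" where "code_tl l = snd (prod_decode (l - 1))"

lemma code_hd_encode [simp]: "code_hd (list_encode (x # xs)) = x"
  by (simp add: code_hd_def)

lemma code_tl_encode [simp]: "code_tl (list_encode (x # xs)) = list_encode xs"
  by (simp add: code_tl_def)

lemma code_drop_encode: "(code_tl ^^ k) (list_encode xs) = list_encode (drop k xs)"
proof (induction k arbitrary: xs)
  case (Suc k)
  \<comment> \<open>Since 0 decodes to the pair of zeros, dropping past the end stays at 0, the code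
    of the empty list.\<close>
  have "code_tl 0 = 0"
    using prod_encode_inverse[of "(0, 0)"]
    by (simp add: code_tl_def prod_encode_def)
  then have "code_tl (list_encode xs) = list_encode (drop 1 xs)"
    by (cases xs) (simp_all del: list_encode.simps(2))
  then show ?case by (simp add: Suc funpow_Suc_right del: funpow.simps)
qed simp

lemma recursive_code_hd: "recursive f \<Longrightarrow> recursive (\<lambda>x. code_hd (f x))"
  unfolding code_hd_def by (intro recursive_fst recursive_pred)

lemma recursive_code_tl: "recursive f \<Longrightarrow> recursive (\<lambda>x. code_tl (f x))"
  unfolding code_tl_def by (intro recursive_snd recursive_pred)

lemma recursive_code_drop:
  "recursive n \<Longrightarrow> recursive f \<Longrightarrow> recursive (\<lambda>x. (code_tl ^^ n x) (f x))"
  by (intro recursive_funpow recursive_code_tl recursive_id)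

text \<open>The code of a list thus bounds its positions, so quantifiers over positions are bounded
  without computing a length.\<close>

lemma length_le_list_encode: "length xs \<le> list_encode xs"
proof (induction xs)
  case (Cons x xs)
  have "list_encode xs \<le> prod_encode (x, list_encode xs)" by (rule le_prod_encode_2)
  with Cons show ?case by simp
qed simp

text \<open>A derivation is the code of a list whose entries are pairs of a derived number and a witness,
  which is either a witness for membership in the base set or the environment of the clause that
  was applied to numbers derived further down in the list.\<close>

definition occurs :: "nat \<Rightarrow> nat \<Rightarrow> bool" where
  "occurs x l \<longleftrightarrow> (\<exists>j<l. (code_tl ^^ j) l \<noteq> 0 \<and> fst (prod_decode (code_hd ((code_tl ^^ j) l))) = x)"

text \<open>The case \<open>l = 0\<close> is accepted because \<open>derivation\<close> also
  inspects positions beyond the end of the list.\<close>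

definition justified :: "clause list \<Rightarrow> nat set \<Rightarrow> nat \<Rightarrow> bool" where
  "justified P R l \<longleftrightarrow> l = 0 \<or> code_hd l \<in> R \<or>
     (\<exists>r\<in>set P. fst (prod_decode (code_hd l)) = pat_value (env (snd (prod_decode (code_hd l)))) (snd r)
        \<and> (\<forall>p\<in>set (fst r). occurs (pat_value (env (snd (prod_decode (code_hd l)))) p) (code_tl l)))"

definition derivation :: "clause list \<Rightarrow> nat set \<Rightarrow> nat \<Rightarrow> bool" where
  "derivation P R l \<longleftrightarrow> (\<forall>k<l. justified P R ((code_tl ^^ k) l))"

section \<open>Decidability of the derivation predicate\<close>

lemma recursive_set_occurs:
  assumes "recursive f" "recursive g"
  shows "recursive_set {x. occurs (f x) (g x)}"
  unfolding occurs_def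
  by (intro recursive_set_bex_less recursive_set_conj recursive_set_Not recursive_set_eq_0
      recursive_set_eq recursive_fst recursive_code_hd recursive_code_drop recursive_snd
      recursive_comp[OF assms(1)] recursive_comp[OF assms(2)] recursive_id assms)

lemma recursive_set_justified:
  assumes "recursive_set R" "recursive f"
  shows "recursive_set {x. justified P R (f x)}"
  unfolding justified_def
  by (intro recursive_set_disj recursive_set_eq_0 recursive_set_vimage[OF assms(1)]
      recursive_set_Bex_list recursive_set_conj recursive_set_eq recursive_set_Ball_list
      recursive_set_occurs recursive_pat_value recursive_fst recursive_snd recursive_code_hd
      recursive_code_tl assms(2))

lemma recursive_set_derivation:
  assumes "recursive_set R" "recursive f"
  shows "recursive_set {x. derivation P R (f x)}"
  unfolding derivation_def
  by (intro recursive_set_ball_less recursive_set_justified recursive_code_drop recursive_snd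
      recursive_comp[OF assms(2)] recursive_fst recursive_id assms)

section \<open>Soundness and completeness of coded derivations\<close>

lemma occurs_encode: "occurs x (list_encode xs) \<longleftrightarrow> x \<in> (\<lambda>y. fst (prod_decode y)) ` set xs"
proof
  assume "occurs x (list_encode xs)"
  then obtain j where j: "list_encode (drop j xs) \<noteq> 0"
    "fst (prod_decode (code_hd (list_encode (drop j xs)))) = x"
    unfolding occurs_def code_drop_encode by blast
  then obtain y ys where ys: "drop j xs = y # ys" by (cases "drop j xs") auto
  then have "y \<in> set xs" by (metis in_set_dropD list.set_intros(1))
  then show "x \<in> (\<lambda>y. fst (prod_decode y)) ` set xs" using j(2) unfolding ys code_hd_encode by blast
next
  assume "x \<in> (\<lambda>y. fst (prod_decode y)) ` set xs"
  then obtain j where j: "j < length xs" "fst (prod_decode (xs ! j)) = x"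
    by (auto simp: in_set_conv_nth)
  then have "drop j xs = xs ! j # drop (Suc j) xs" by (simp add: Cons_nth_drop_Suc)
  then have "list_encode (drop j xs) \<noteq> 0" "code_hd (list_encode (drop j xs)) = xs ! j"
    by (simp_all add: code_hd_def)
  then show "occurs x (list_encode xs)"
    unfolding occurs_def code_drop_encode
    using j length_le_list_encode[of xs] by (intro exI[of _ j]) simp
qed

lemma derivation_Nil: "derivation P R (list_encode [])"
  by (simp add: derivation_def)

lemma derivation_Cons:
  "derivation P R (list_encode (x # xs)) \<longleftrightarrow>
     justified P R (list_encode (x # xs)) \<and> derivation P R (list_encode xs)"
proof -
  have all: "derivation P R (list_encode ys) \<longleftrightarrow> (\<forall>k. justified P R (list_encode (drop k ys)))" for ys
  proof -
    have "justified P R (list_encode (drop k ys))" if "\<not> k < list_encode ys" for k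
      using that length_le_list_encode[of ys] by (simp add: justified_def)
    then show ?thesis unfolding derivation_def code_drop_encode by blast
  qed
  have "(\<forall>k. justified P R (list_encode (drop k (x # xs)))) \<longleftrightarrow>
     justified P R (list_encode (x # xs)) \<and> (\<forall>k. justified P R (list_encode (drop k xs)))"
    by (metis drop0 drop_Suc_Cons not0_implies_Suc)
  then show ?thesis unfolding all .
qed

text \<open>Premises are looked up by occurrence and not by position, so a longer tail does no harm.
  This is what allows derivations to be concatenated.\<close>

lemma justified_mono:
  assumes "justified P R (list_encode (x # xs))" "set xs \<subseteq> set ys"
  shows "justified P R (list_encode (x # ys))"
proof -
  have "occurs y (list_encode ys)" if "occurs y (list_encode xs)" for y
    using that assms(2) unfolding occurs_encode by blast
  moreover have "list_encode (x # xs) \<noteq> 0" by simp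
  ultimately show ?thesis
    using assms(1) unfolding justified_def code_hd_encode code_tl_encode by meson
qed

lemma derivation_append:
  "derivation P R (list_encode xs) \<Longrightarrow> derivation P R (list_encode ys) \<Longrightarrow>
   derivation P R (list_encode (xs @ ys))"
  by (induction xs) (auto simp: derivation_Cons simp del: list_encode.simps intro: justified_mono)

text \<open>An entry refers only to numbers in its own tail, so induction along the list
  applies.\<close>

lemma derivation_sound:
  assumes R: "\<And>x w. prod_encode (x, w) \<in> R \<Longrightarrow> x \<in> B"
  shows "derivation P R (list_encode xs) \<Longrightarrow> occurs x (list_encode xs) \<Longrightarrow> derives P B x"
proof (induction xs arbitrary: x)
  case Nil
  then show ?case by (simp add: occurs_def)
next
  case (Cons a xs)
  have IH: "derives P B y" if "occurs y (list_encode xs)" for y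
    using Cons.IH Cons.prems(1) that by (simp add: derivation_Cons del: list_encode.simps)
  have "derives P B (fst (prod_decode a))"
  proof -
    have "justified P R (list_encode (a # xs))" using Cons.prems(1) by (simp only: derivation_Cons)
    moreover have "list_encode (a # xs) \<noteq> 0" by simp
    ultimately consider "a \<in> R" | ps c where "(ps, c) \<in> set P"
        "fst (prod_decode a) = pat_value (env (snd (prod_decode a))) c"
        "\<forall>p\<in>set ps. occurs (pat_value (env (snd (prod_decode a))) p) (list_encode xs)"
      unfolding justified_def code_hd_encode code_tl_encode by fastforce
    then show ?thesis
    proof cases
      case 1
      then show ?thesis using R by (metis base prod.collapse prod_decode_inverse)
    next
      case 2
      then show ?thesis by (metis IH clause)
    qed
  qed
  then show ?case
    using Cons.prems(2) IH unfolding occurs_encode by auto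
qed

lemma derivation_complete:
  assumes R: "\<And>x. x \<in> B \<Longrightarrow> \<exists>w. prod_encode (x, w) \<in> R"
  shows "derives P B x \<Longrightarrow> \<exists>xs. derivation P R (list_encode xs) \<and> occurs x (list_encode xs)"
proof (induction rule: derives.induct)
  case (base x)
  then obtain w where "prod_encode (x, w) \<in> R" using R by blast
  then have "derivation P R (list_encode [prod_encode (x, w)])"
    unfolding derivation_Cons justified_def code_hd_encode using derivation_Nil by blast
  moreover have "occurs x (list_encode [prod_encode (x, w)])" unfolding occurs_encode by simp
  ultimately show ?case by blast
next
  case (clause ps c e)
  \<comment> \<open>The derivations of the individual premises are merged into a single one by
    concatenation.\<close>
  have "\<exists>xs. derivation P R (list_encode xs) \<and> (\<forall>p\<in>set qs. occurs (pat_value e p) (list_encode xs))"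
    if "set qs \<subseteq> set ps" for qs
    using that
  proof (induction qs)
    case Nil
    show ?case using derivation_Nil by fastforce
  next
    case (Cons q qs)
    then obtain xs ys where "derivation P R (list_encode xs)"
        "\<forall>p\<in>set qs. occurs (pat_value e p) (list_encode xs)"
        "derivation P R (list_encode ys)" "occurs (pat_value e q) (list_encode ys)"
      using clause.IH by fastforce
    then show ?case
      by (intro exI[of _ "xs @ ys"]) (auto simp: derivation_append occurs_encode)
  qed
  then obtain xs where xs: "derivation P R (list_encode xs)"
      "\<forall>p\<in>set ps. occurs (pat_value e p) (list_encode xs)" by blast
  obtain w where w: "\<forall>p\<in>set (c # ps). pat_value (env w) p = pat_value e p"
    using ex_env_clause by blast
  let ?x = "prod_encode (pat_value e c, w)"
  have "justified P R (list_encode (?x # xs))"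
    unfolding justified_def code_hd_encode code_tl_encode
    using clause.hyps(1) xs(2) w by (intro disjI2 bexI[of _ "(ps, c)"]) auto
  then have "derivation P R (list_encode (?x # xs))" using xs(1) by (simp only: derivation_Cons)
  moreover have "occurs (pat_value e c) (list_encode (?x # xs))" unfolding occurs_encode by simp
  ultimately show ?case by blast
qed

lemma semidecidable_derives:
  assumes "semidecidable B"
  shows "semidecidable {x. derives P B x}"
proof -
  obtain R where R: "recursive_set R" "\<And>x. x \<in> B \<longleftrightarrow> (\<exists>d. prod_encode (x, d) \<in> R)"
    using assms unfolding semidecidable_def by blast
  let ?R = "{y. derivation P R (snd (prod_decode y)) \<and> occurs (fst (prod_decode y)) (snd (prod_decode y))}"
  have "recursive_set ?R"
    by (intro recursive_set_conj recursive_set_derivation recursive_set_occurs R(1) recursive_fst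
        recursive_snd recursive_id)
  moreover have "derives P B x \<longleftrightarrow> (\<exists>d. derivation P R d \<and> occurs x d)" for x
  proof
    show "\<exists>d. derivation P R d \<and> occurs x d" if "derives P B x"
      using derivation_complete[OF _ that, of R] R(2) by blast
  next
    assume "\<exists>d. derivation P R d \<and> occurs x d"
    then obtain xs where "derivation P R (list_encode xs)" "occurs x (list_encode xs)"
      by (metis list_decode_inverse)
    then show "derives P B x" using derivation_sound[of R B P xs x] R(2) by blast
  qed
  ultimately show ?thesis
    unfolding semidecidable_def by (intro exI[of _ ?R]) simp
qed


subsection \<open>A universal program\<close>

abbreviation prog_pat :: "pat \<Rightarrow> pat" where
  "prog_pat c \<equiv> PPair (PConst 0) c"
abbreviation ev_pat :: "pat \<Rightarrow> pat \<Rightarrow> pat \<Rightarrow> pat" where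
  "ev_pat c x y \<equiv> PPair (PConst 1) (PPair c (PPair x y))"
abbreviation pos_below_pat :: "pat \<Rightarrow> pat \<Rightarrow> pat \<Rightarrow> pat" where
  "pos_below_pat c x k \<equiv> PPair (PConst 2) (PPair c (PPair x k))"
abbreviation W_pat :: "pat \<Rightarrow> pat \<Rightarrow> pat" where
  "W_pat c x \<equiv> PPair (PConst 3) (PPair c x)"

abbreviation V0 :: pat where "V0 \<equiv> PVar 0"
abbreviation V1 :: pat where "V1 \<equiv> PVar 1"
abbreviation V2 :: pat where "V2 \<equiv> PVar 2"
abbreviation V3 :: pat where "V3 \<equiv> PVar 3"
abbreviation V4 :: pat where "V4 \<equiv> PVar 4"
abbreviation V5 :: pat where "V5 \<equiv> PVar 5"

abbreviation node_pat :: "nat \<Rightarrow> pat \<Rightarrow> pat \<Rightarrow> pat" where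
  "node_pat n c d \<equiv> PPair (PConst n) (PPair c d)"

text \<open>Horn clauses have no bounded universal quantifier, so the condition in
  \<open>ev_Mu\<close> becomes the predicate of \<open>pos_below_pat\<close>, generated by recursion
  on the bound. In the base clause for primitive recursion the step program is not run; there
  \<open>prog_pat\<close> ensures that its code really is one.\<close>

definition ev_clauses :: "clause list" where
  "ev_clauses =
    [([], prog_pat (PConst (recfn_code ZeroF))),
     ([], prog_pat (PConst (recfn_code SuccF))),
     ([], prog_pat (PConst (recfn_code FstF))),
     ([], prog_pat (PConst (recfn_code SndF))),
     ([prog_pat V0, prog_pat V1], prog_pat (node_pat 4 V0 V1)),
     ([prog_pat V0, prog_pat V1], prog_pat (node_pat 5 V0 V1)),
     ([prog_pat V0, prog_pat V1], prog_pat (node_pat 6 V0 V1)),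
     ([prog_pat V0], prog_pat (PPair (PConst 7) V0)),
     ([], ev_pat (PConst (recfn_code ZeroF)) V0 (PConst 0)),
     ([], ev_pat (PConst (recfn_code SuccF)) V0 (PSuc V0)),
     ([], ev_pat (PConst (recfn_code FstF)) (PPair V0 V1) V0),
     ([], ev_pat (PConst (recfn_code SndF)) (PPair V0 V1) V1),
     ([ev_pat V0 V2 V3, ev_pat V1 V2 V4], ev_pat (node_pat 4 V0 V1) V2 (PPair V3 V4)),
     ([ev_pat V1 V2 V3, ev_pat V0 V3 V4], ev_pat (node_pat 5 V0 V1) V2 V4),
     ([ev_pat V0 V2 V3, prog_pat V1], ev_pat (node_pat 6 V0 V1) (PPair V2 (PConst 0)) V3),
     ([ev_pat (node_pat 6 V0 V1) (PPair V2 V3) V4,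
       ev_pat V1 (PPair V2 (PPair V3 V4)) V5],
      ev_pat (node_pat 6 V0 V1) (PPair V2 (PSuc V3)) V5),
     ([ev_pat V0 (PPair V1 V2) (PConst 0), pos_below_pat V0 V1 V2],
      ev_pat (PPair (PConst 7) V0) V1 V2),
     ([], pos_below_pat V0 V1 (PConst 0)),
     ([pos_below_pat V0 V1 V2, ev_pat V0 (PPair V1 V2) (PSuc V3)],
      pos_below_pat V0 V1 (PSuc V2)),
     ([ev_pat V0 V1 V2], W_pat V0 V1)]"

text \<open>Tag 2 quantifies universally over \<open>p\<close> because facts of
  \<open>pos_below_pat\<close> with bound 0 are derivable for every number, including those that
  code no program.\<close>

definition ev_meaning :: "nat \<Rightarrow> bool" where
  "ev_meaning z = (case prod_decode z of (t, a) \<Rightarrow>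
     if t = 0 then \<exists>p. recfn_code p = a
     else case prod_decode a of (c, b) \<Rightarrow>
       if t = 3 then b \<in> W c
       else case prod_decode b of (x, y) \<Rightarrow>
         if t = 1 then \<exists>p. recfn_code p = c \<and> ev p x y
         else \<forall>p. recfn_code p = c \<longrightarrow> (\<forall>m<y. \<exists>r. ev p (prod_encode (x, m)) (Suc r)))"

lemma ev_meaning_simps:
  "ev_meaning (prod_encode (0, c)) \<longleftrightarrow> (\<exists>p. c = recfn_code p)"
  "ev_meaning (prod_encode (Suc 0, prod_encode (c, prod_encode (x, y)))) \<longleftrightarrow> (\<exists>p. c = recfn_code p \<and> ev p x y)"
  "ev_meaning (prod_encode (2, prod_encode (c, prod_encode (x, y)))) \<longleftrightarrow>
     (\<forall>p. c = recfn_code p \<longrightarrow> (\<forall>m<y. \<exists>r. ev p (prod_encode (x, m)) (Suc r)))"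
  "ev_meaning (prod_encode (3, prod_encode (c, x))) \<longleftrightarrow> x \<in> W c"
  unfolding ev_meaning_def by auto

lemma node_eq_recfn_code_iff:
  "prod_encode (4, prod_encode (c, d)) = recfn_code r \<longleftrightarrow>
     (\<exists>p q. r = PairF p q \<and> c = recfn_code p \<and> d = recfn_code q)"
  "prod_encode (5, prod_encode (c, d)) = recfn_code r \<longleftrightarrow>
     (\<exists>p q. r = CompF p q \<and> c = recfn_code p \<and> d = recfn_code q)"
  "prod_encode (6, prod_encode (c, d)) = recfn_code r \<longleftrightarrow>
     (\<exists>p q. r = PrecF p q \<and> c = recfn_code p \<and> d = recfn_code q)"
  "prod_encode (7, c) = recfn_code r \<longleftrightarrow> (\<exists>p. r = MuF p \<and> c = recfn_code p)"
  by (cases r; auto)+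

lemma ev_clauses_sound:
  assumes "derives ev_clauses {} z"
  shows "ev_meaning z"
  using assms
proof (rule derives_sound)
  \<comment> \<open>The clauses for the projections match an input pair, so the rules are restated
    for encoded pairs.\<close>
  have "ev FstF (prod_encode (a, b)) a" "ev SndF (prod_encode (a, b)) b" for a b
    using ev_Fst[of "prod_encode (a, b)"] ev_Snd[of "prod_encode (a, b)"] by simp_all
  then show "\<forall>(ps, c)\<in>set ev_clauses. \<forall>e.
      (\<forall>p\<in>set ps. ev_meaning (pat_value e p)) \<longrightarrow> ev_meaning (pat_value e c)"
    unfolding ev_clauses_def
    by (auto simp: ev_meaning_simps node_eq_recfn_code_iff less_Suc_eq W_def
        simp del: recfn_code.simps intro: ev.intros)
qed simp

text \<open>Lets the completeness proofs select a clause by its position and pass the values of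
  \<open>V0\<close>, \<open>V1\<close>, ... as \<open>nth\<close> of a list.\<close>

lemma derives_nth:
  assumes "n < length P" "\<forall>p\<in>set (fst (P ! n)). derives P B (pat_value e p)"
  shows "derives P B (pat_value e (snd (P ! n)))"
  using derives.clause[of "fst (P ! n)" "snd (P ! n)" P B e] assms by simp

abbreviation ev_derivable :: "nat \<Rightarrow> bool" where
  "ev_derivable \<equiv> derives ev_clauses {}"

lemma ev_clauses_prog: "ev_derivable (prod_encode (0, recfn_code p))"
proof (induction p)
  case ZeroF
  show ?case using derives_nth[of 0 ev_clauses] by (simp add: ev_clauses_def)
next
  case SuccF
  show ?case using derives_nth[of 1 ev_clauses] by (simp add: ev_clauses_def)
next
  case FstF
  show ?case using derives_nth[of 2 ev_clauses] by (simp add: ev_clauses_def)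
next
  case SndF
  show ?case using derives_nth[of 3 ev_clauses] by (simp add: ev_clauses_def)
next
  case (PairF p q)
  then show ?case using derives_nth[of 4 ev_clauses _ "nth [recfn_code p, recfn_code q]"]
    by (simp add: ev_clauses_def)
next
  case (CompF p q)
  then show ?case using derives_nth[of 5 ev_clauses _ "nth [recfn_code p, recfn_code q]"]
    by (simp add: ev_clauses_def)
next
  case (PrecF p q)
  then show ?case using derives_nth[of 6 ev_clauses _ "nth [recfn_code p, recfn_code q]"]
    by (simp add: ev_clauses_def)
next
  case (MuF p)
  then show ?case using derives_nth[of 7 ev_clauses _ "nth [recfn_code p]"]
    by (simp add: ev_clauses_def)
qed

lemma ev_clauses_ev: "ev p x y \<Longrightarrow> ev_derivable (prod_encode (1, prod_encode (recfn_code p, prod_encode (x, y))))"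
proof (induction rule: ev.induct)
  case (ev_Zero x)
  show ?case using derives_nth[of 8 ev_clauses _ "nth [x]"] by (simp add: ev_clauses_def)
next
  case (ev_Succ x)
  show ?case using derives_nth[of 9 ev_clauses _ "nth [x]"] by (simp add: ev_clauses_def)
next
  case (ev_Fst x)
  show ?case using derives_nth[of 10 ev_clauses _ "nth [fst (prod_decode x), snd (prod_decode x)]"]
    by (simp add: ev_clauses_def)
next
  case (ev_Snd x)
  show ?case using derives_nth[of 11 ev_clauses _ "nth [fst (prod_decode x), snd (prod_decode x)]"]
    by (simp add: ev_clauses_def)
next
  case (ev_Pair p x a q b)
  then show ?case
    using derives_nth[of 12 ev_clauses _ "nth [recfn_code p, recfn_code q, x, a, b]"]
    by (simp add: ev_clauses_def)
next
  case (ev_Comp q x y p z)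
  then show ?case
    using derives_nth[of 13 ev_clauses _ "nth [recfn_code p, recfn_code q, x, y, z]"]
    by (simp add: ev_clauses_def)
next
  case (ev_Prec_0 p a b q)
  then show ?case
    using derives_nth[of 14 ev_clauses _ "nth [recfn_code p, recfn_code q, a, b]"] ev_clauses_prog[of q]
    by (simp add: ev_clauses_def)
next
  case (ev_Prec_Suc p q a k r s)
  then show ?case
    using derives_nth[of 15 ev_clauses _ "nth [recfn_code p, recfn_code q, a, k, r, s]"]
    by (simp add: ev_clauses_def)
next
  case (ev_Mu p a k)
  \<comment> \<open>The outputs at the arguments below \<open>k\<close> are chained into facts of
    \<open>pos_below_pat\<close>, one bound at a time.\<close>
  have "ev_derivable (prod_encode (2, prod_encode (recfn_code p, prod_encode (a, m))))" if "m \<le> k" for m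
    using that
  proof (induction m)
    case 0
    show ?case using derives_nth[of 17 ev_clauses _ "nth [recfn_code p, a]"]
      by (simp add: ev_clauses_def)
  next
    case (Suc m)
    obtain r where "ev_derivable (prod_encode (1, prod_encode (recfn_code p, prod_encode (prod_encode (a, m), Suc r))))"
      using ev_Mu.IH(2) Suc.prems by (meson Suc_le_lessD)
    then show ?case
      using Suc derives_nth[of 18 ev_clauses _ "nth [recfn_code p, a, m, r]"]
      by (simp add: ev_clauses_def)
  qed
  with ev_Mu.IH(1) show ?case
    using derives_nth[of 16 ev_clauses _ "nth [recfn_code p, a, k]"]
    by (simp add: ev_clauses_def)
qed

lemma ev_clauses_W: "x \<in> W i \<longleftrightarrow> ev_derivable (prod_encode (3, prod_encode (i, x)))"
proof
  assume "x \<in> W i"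
  then obtain p y where "recfn_code p = i" "ev p x y" unfolding W_def by blast
  then show "ev_derivable (prod_encode (3, prod_encode (i, x)))"
    using ev_clauses_ev[of p x y] derives_nth[of 19 ev_clauses _ "nth [i, x, y]"]
    by (simp add: ev_clauses_def)
next
  assume "ev_derivable (prod_encode (3, prod_encode (i, x)))"
  then show "x \<in> W i" using ev_clauses_sound ev_meaning_simps(4) by blast
qed

text \<open>The point is uniformity in the index: the race between two enumerations takes both
  indices as part of its input.\<close>

lemma semidecidable_W: "semidecidable {z. snd (prod_decode z) \<in> W (fst (prod_decode z))}"
proof -
  have "semidecidable {z. prod_encode (3, z) \<in> {y. ev_derivable y}}"
    by (intro semidecidable_vimage semidecidable_derives semidecidable_empty recursive_pair
        recursive_const recursive_id)
  moreover have "snd (prod_decode z) \<in> W (fst (prod_decode z)) \<longleftrightarrow> ev_derivable (prod_encode (3, z))" for z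
    by (simp add: ev_clauses_W)
  ultimately show ?thesis by simp
qed


subsection \<open>Theories axiomatised by propositional literals\<close>

text \<open>Symbols of arity 0 act as propositional letters. Without function symbols the variables
  are the only terms, so the substitutions in the logical axioms are mere renamings.\<close>

definition literal_theory :: "nat set \<Rightarrow> nat set \<Rightarrow> fo_theory" where
  "literal_theory A B = \<lparr> funs = {}, rels = {(n, 0) | n. True},
     axs = {Rel n [] | n. n \<in> A} \<union> {Neg (Rel n []) | n. n \<in> B} \<rparr>"

lemma literal_theory_simps [simp]:
  "funs (literal_theory A B) = {}"
  "rels (literal_theory A B) = {(n, 0) | n. True}"
  "axs (literal_theory A B) = {Rel n [] | n. n \<in> A} \<union> {Neg (Rel n []) | n. n \<in> B}"
  by (simp_all add: literal_theory_def)

lemma wf_tm_literal_theory [simp]: "wf_tm (literal_theory A B) t \<longleftrightarrow> (\<exists>x. t = Var x)"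
  by (cases t) auto

text \<open>Truth in the one-element structure.\<close>

primrec sat :: "(nat \<Rightarrow> bool) \<Rightarrow> fm \<Rightarrow> bool" where
  "sat v Fls \<longleftrightarrow> False"
| "sat v (Eq s t) \<longleftrightarrow> True"
| "sat v (Rel r ts) \<longleftrightarrow> v r"
| "sat v (Imp \<phi> \<psi>) \<longleftrightarrow> (sat v \<phi> \<longrightarrow> sat v \<psi>)"
| "sat v (Forall \<phi>) \<longleftrightarrow> sat v \<phi>"

lemma sat_subst [simp]: "sat v (subst \<sigma> \<phi>) \<longleftrightarrow> sat v \<phi>"
  by (induction \<phi> arbitrary: \<sigma>) auto

text \<open>Truth in a one-element structure ignores terms and variables, so instantiation, lifting
  and the equality axioms are harmless.\<close>

lemma sat_provable:
  assumes "provable T \<phi>" "\<And>\<psi>. \<psi> \<in> axs T \<Longrightarrow> sat v \<psi>"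
  shows "sat v \<phi>"
  using assms by (induction rule: provable.induct) (auto simp: inst_def lift_def)

lemma sat_literal_theory:
  assumes "A \<inter> B = {}" "provable (literal_theory A B) \<phi>"
  shows "sat (\<lambda>n. n \<in> A) \<phi>"
  using assms by (intro sat_provable[OF assms(2)]) auto

section \<open>Failure to interpret Num\<close>

text \<open>The single element is a value of zero and of its own successor, and it witnesses every
  quantifier of the unravelling. Hence it is a value of every numeral, whatever the variable indices
  are.\<close>

lemma sat_value_tr_numeral:
  assumes "sat v (domI I)" "sat v (zeroI I)" "sat v (sucI I)"
  shows "sat v (value_tr I d (numeral_tm k) y)"
proof (induction k arbitrary: d y)
  case 0
  show ?case using assms by (simp add: app1_def)
next
  case (Suc k)
  obtain f ts where "numeral_tm k = Fn f ts" by (cases k) auto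
  then show ?case using Suc assms by (simp add: app1_def app2_def)
qed

lemma not_interpretation_of_Num:
  assumes "\<And>\<psi>. \<psi> \<in> axs T \<Longrightarrow> sat v \<psi>"
  shows "\<not> interpretation_of_Num T I"
proof
  assume I: "interpretation_of_Num T I"
  have sat: "sat v \<phi>" if "provable T \<phi>" for \<phi> using sat_provable[OF that] assms by blast
  \<comment> \<open>Totality of zero gives the first two facts; totality of the successor on the
    domain, now known to be inhabited, gives the third.\<close>
  have I_sat: "sat v (domI I)" "sat v (zeroI I)" "sat v (sucI I)"
  proof -
    have "provable T (Exists (Conj (app1 (domI I) 0) (app1 (zeroI I) 0)))"
      "provable T (Forall (Imp (app1 (domI I) 0) (Exists (Conj (app1 (domI I) 0) (app2 (sucI I) 1 0)))))"
      using I unfolding interpretation_of_Num_def by blast+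
    from this[THEN sat] show "sat v (domI I)" "sat v (zeroI I)" "sat v (sucI I)"
      by (simp_all add: app1_def app2_def)
  qed
  let ?\<phi> = "Neg (Eq (numeral_tm 0) (numeral_tm (Suc 0)))"
  have "0 \<noteq> Suc 0" by simp
  then have "?\<phi> \<in> {Neg (Eq (numeral_tm m) (numeral_tm n)) | m n. m \<noteq> n}" by blast
  then have "?\<phi> \<in> axs Num" unfolding Num_def fo_theory.simps by blast
  moreover have "is_sentence Num ?\<phi>" by (simp add: is_sentence_def Num_def)
  ultimately have "sat v (translate I ?\<phi>)"
    using I sat provable.Ax unfolding interpretation_of_Num_def by blast
  \<comment> \<open>The translated equation asks for a common value of two numerals in the domain,
    and the single element is one.\<close>
  moreover have "sat v (translate I (Eq (numeral_tm 0) (numeral_tm (Suc 0))))"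
    using I_sat sat_value_tr_numeral[OF I_sat, of 1 0] sat_value_tr_numeral[OF I_sat, of 1 "Suc 0"]
    by (simp add: app1_def)
  ultimately show False by simp
qed

section \<open>Injectivity of the codes of terms and formulas\<close>

lemma tm_code_inject [simp]: "tm_code s = tm_code t \<longleftrightarrow> s = t"
proof
  show "tm_code s = tm_code t \<Longrightarrow> s = t"
  proof (induction s arbitrary: t)
    case (Var x)
    then show ?case by (cases t) auto
  next
    case (Fn f ts)
    then obtain us where us: "t = Fn f us" "map tm_code ts = map tm_code us"
      by (cases t) (auto simp: list_encode_eq)
    from us(2) Fn.IH have "ts = us"
    proof (induction ts arbitrary: us)
      case (Cons a ts)
      then show ?case by (cases us) auto
    qed simp
    then show ?case using us by simp
  qed
qed simp

lemma fm_code_inject [simp]: "fm_code \<phi> = fm_code \<psi> \<longleftrightarrow> \<phi> = \<psi>"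
proof
  have "inj tm_code" by (rule injI) simp
  then have map: "map tm_code ts = map tm_code us \<longleftrightarrow> ts = us" for ts us
    by (simp add: inj_map_eq_map)
  show "fm_code \<phi> = fm_code \<psi> \<Longrightarrow> \<phi> = \<psi>"
  proof (induction \<phi> arbitrary: \<psi>)
    case Fls
    then show ?case by (cases \<psi>) auto
  next
    case (Eq s t)
    then show ?case by (cases \<psi>) auto
  next
    case (Rel r ts)
    then show ?case by (cases \<psi>) (auto simp: list_encode_eq map)
  next
    case (Imp \<phi>1 \<phi>2)
    then show ?case by (cases \<psi>) auto
  next
    case (Forall \<phi>)
    then show ?case by (cases \<psi>) auto
  qed
qed simp

lemma eq_tm_code_Var_iff: "prod_encode (0, x) = tm_code t \<longleftrightarrow> t = Var x"
  by (cases t) auto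

lemma node_eq_fm_code_iff:
  "prod_encode (0, 0) = fm_code \<phi> \<longleftrightarrow> \<phi> = Fls"
  "prod_encode (Suc 0, prod_encode (c, d)) = fm_code \<phi> \<longleftrightarrow>
     (\<exists>s t. \<phi> = Eq s t \<and> c = tm_code s \<and> d = tm_code t)"
  "prod_encode (2, prod_encode (n, 0)) = fm_code \<phi> \<longleftrightarrow> \<phi> = Rel n []"
  "prod_encode (3, prod_encode (c, d)) = fm_code \<phi> \<longleftrightarrow>
     (\<exists>\<psi> \<chi>. \<phi> = Imp \<psi> \<chi> \<and> c = fm_code \<psi> \<and> d = fm_code \<chi>)"
  "prod_encode (4, c) = fm_code \<phi> \<longleftrightarrow> (\<exists>\<psi>. \<phi> = Forall \<psi> \<and> c = fm_code \<psi>)"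
proof -
  \<comment> \<open>Patterns for letters write the empty argument list as the constant 0.\<close>
  have "0 = list_encode us \<longleftrightarrow> us = []" for us by (cases us) auto
  then show "prod_encode (2, prod_encode (n, 0)) = fm_code \<phi> \<longleftrightarrow> \<phi> = Rel n []"
    by (cases \<phi>) auto
qed (cases \<phi>; auto)+

text \<open>\<open>shift m k\<close> is the renaming of variables performed under \<open>k\<close> binders by \<^const>\<open>lift\<close> (if
  \<open>m = 0\<close>) and by \<^const>\<open>inst\<close> with the variable \<open>y\<close> (if \<open>m = Suc y\<close>).\<close>

fun shift :: "nat \<Rightarrow> nat \<Rightarrow> nat \<Rightarrow> nat" where
  "shift m (Suc k) 0 = 0"
| "shift m (Suc k) (Suc x) = Suc (shift m k x)"
| "shift 0 0 x = Suc x"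
| "shift (Suc y) 0 0 = y"
| "shift (Suc y) 0 (Suc x) = x"

abbreviation rename :: "nat \<Rightarrow> nat \<Rightarrow> fm \<Rightarrow> fm" where
  "rename m k \<equiv> subst (\<lambda>x. Var (shift m k x))"

text \<open>Passing a binder only raises \<open>k\<close>, so the renamings stay within a family
  described by two numbers. Renaming thereby becomes a predicate on numbers that Horn clauses can
  define.\<close>

lemma rename_Forall: "rename m k (Forall \<phi>) = Forall (rename m (Suc k) \<phi>)"
proof -
  have "case_nat (Var 0) (\<lambda>x. lift_tm (Var (shift m k x))) = (\<lambda>x. Var (shift m (Suc k) x))"
    by (auto simp: lift_tm_def split: nat.split)
  then show ?thesis by simp
qed

lemma lift_eq_rename: "lift = rename 0 0"
  by (simp add: lift_def[abs_def] fun_eq_iff)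

lemma inst_eq_rename: "inst (Var y) = rename (Suc y) 0"
proof -
  have "case_nat (Var y) Var = (\<lambda>x. Var (shift (Suc y) 0 x))"
    by (auto split: nat.split)
  then show ?thesis by (simp add: inst_def)
qed

section \<open>The Hilbert calculus as a Horn program\<close>

abbreviation less_pat :: "pat \<Rightarrow> pat \<Rightarrow> pat" where
  "less_pat x y \<equiv> PPair (PConst 0) (PPair x y)"
abbreviation shift_pat :: "pat \<Rightarrow> pat \<Rightarrow> pat \<Rightarrow> pat \<Rightarrow> pat" where
  "shift_pat m k x y \<equiv> PPair (PConst 1) (PPair m (PPair k (PPair x y)))"
abbreviation rename_pat :: "pat \<Rightarrow> pat \<Rightarrow> pat \<Rightarrow> pat \<Rightarrow> pat" where
  "rename_pat m k c d \<equiv> PPair (PConst 2) (PPair m (PPair k (PPair c d)))"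
abbreviation wf_pat :: "pat \<Rightarrow> pat \<Rightarrow> pat" where
  "wf_pat k c \<equiv> PPair (PConst 3) (PPair k c)"
abbreviation provable_pat :: "pat \<Rightarrow> pat" where
  "provable_pat c \<equiv> PPair (PConst 4) c"
abbreviation axiom_pat :: "pat \<Rightarrow> pat" where
  "axiom_pat c \<equiv> PPair (PConst 5) c"

abbreviation Fls_pat :: pat where
  "Fls_pat \<equiv> PPair (PConst 0) (PConst 0)"
abbreviation Eq_pat :: "pat \<Rightarrow> pat \<Rightarrow> pat" where
  "Eq_pat x y \<equiv> PPair (PConst 1) (PPair (PPair (PConst 0) x) (PPair (PConst 0) y))"
abbreviation Rel_pat :: "pat \<Rightarrow> pat" where
  "Rel_pat n \<equiv> PPair (PConst 2) (PPair n (PConst 0))"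
abbreviation Imp_pat :: "pat \<Rightarrow> pat \<Rightarrow> pat" where
  "Imp_pat c d \<equiv> PPair (PConst 3) (PPair c d)"
abbreviation Forall_pat :: "pat \<Rightarrow> pat" where
  "Forall_pat c \<equiv> PPair (PConst 4) c"

text \<open>The first argument of \<open>wf_pat\<close> bounds the free variables: an arbitrary
  bound expresses well-formedness, the bound 0 a sentence. Facts of \<open>rename_pat\<close> are
  derivable only for well-formed formulas, so they also serve as well-formedness premises. Tags 8
  and 9 mark the letters asserted and denied by the axioms; no clause concludes them, so they come
  from the base set alone.\<close>

definition proof_clauses :: "clause list" where
  "proof_clauses =
    [([], less_pat (PConst 0) (PSuc V0)),
     ([less_pat V0 V1], less_pat (PSuc V0) (PSuc V1)),
     ([], shift_pat V0 (PSuc V1) (PConst 0) (PConst 0)),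
     ([shift_pat V0 V1 V2 V3], shift_pat V0 (PSuc V1) (PSuc V2) (PSuc V3)),
     ([], shift_pat (PConst 0) (PConst 0) V0 (PSuc V0)),
     ([], shift_pat (PSuc V0) (PConst 0) (PConst 0) V0),
     ([], shift_pat (PSuc V0) (PConst 0) (PSuc V1) V1),
     ([], rename_pat V0 V1 Fls_pat Fls_pat),
     ([shift_pat V0 V1 V2 V3, shift_pat V0 V1 V4 V5],
      rename_pat V0 V1 (Eq_pat V2 V4) (Eq_pat V3 V5)),
     ([], rename_pat V0 V1 (Rel_pat V2) (Rel_pat V2)),
     ([rename_pat V0 V1 V2 V3, rename_pat V0 V1 V4 V5],
      rename_pat V0 V1 (Imp_pat V2 V4) (Imp_pat V3 V5)),
     ([rename_pat V0 (PSuc V1) V2 V3], rename_pat V0 V1 (Forall_pat V2) (Forall_pat V3)),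
     ([], wf_pat V0 Fls_pat),
     ([less_pat V1 V0, less_pat V2 V0], wf_pat V0 (Eq_pat V1 V2)),
     ([], wf_pat V0 (Rel_pat V1)),
     ([wf_pat V0 V1, wf_pat V0 V2], wf_pat V0 (Imp_pat V1 V2)),
     ([wf_pat (PSuc V0) V1], wf_pat V0 (Forall_pat V1)),
     ([PPair (PConst 8) V0], axiom_pat (Rel_pat V0)),
     ([PPair (PConst 9) V0], axiom_pat (Imp_pat (Rel_pat V0) Fls_pat)),
     ([axiom_pat V0], provable_pat V0),
     ([wf_pat V0 V1, wf_pat V2 V3], provable_pat (Imp_pat V1 (Imp_pat V3 V1))),
     ([wf_pat V0 V1, wf_pat V2 V3, wf_pat V4 V5],
      provable_pat (Imp_pat (Imp_pat V1 (Imp_pat V3 V5))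
        (Imp_pat (Imp_pat V1 V3) (Imp_pat V1 V5)))),
     ([wf_pat V0 V1], provable_pat (Imp_pat (Imp_pat (Imp_pat V1 Fls_pat) Fls_pat) V1)),
     ([rename_pat (PSuc V0) (PConst 0) V1 V2], provable_pat (Imp_pat (Forall_pat V1) V2)),
     ([rename_pat (PConst 0) (PConst 0) V0 V1, wf_pat V2 V3],
      provable_pat (Imp_pat (Forall_pat (Imp_pat V1 V3)) (Imp_pat V0 (Forall_pat V3)))),
     ([], provable_pat (Eq_pat V0 V0)),
     ([rename_pat (PSuc V0) (PConst 0) V2 V3, rename_pat (PSuc V1) (PConst 0) V2 V4],
      provable_pat (Imp_pat (Eq_pat V0 V1) (Imp_pat V3 V4))),
     ([provable_pat (Imp_pat V0 V1), provable_pat V0], provable_pat V1),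
     ([provable_pat V0], provable_pat (Forall_pat V0)),
     ([provable_pat V0, wf_pat (PConst 0) V0], PPair (PConst 6) V0),
     ([provable_pat (Imp_pat V0 Fls_pat), wf_pat (PConst 0) V0], PPair (PConst 7) V0)]"

definition proof_meaning :: "nat set \<Rightarrow> nat set \<Rightarrow> nat \<Rightarrow> bool" where
  "proof_meaning A B z = (let T = literal_theory A B in case prod_decode z of (t, a) \<Rightarrow>
     if t = 4 then \<exists>\<phi>. a = fm_code \<phi> \<and> provable T \<phi>
     else if t = 5 then a \<in> fm_code ` axs T
     else if t = 6 then a \<in> provable_codes T
     else if t = 7 then a \<in> refutable_codes T
     else if t = 8 then a \<in> A
     else if t = 9 then a \<in> B
     else case prod_decode a of (x, b) \<Rightarrow>
       if t = 0 then x < b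
       else if t = 3 then \<exists>\<phi>. b = fm_code \<phi> \<and> wf_fm T \<phi> \<and> fv \<phi> \<subseteq> {..<x}
       else case prod_decode b of (y, c) \<Rightarrow> case prod_decode c of (u, v) \<Rightarrow>
         if t = 1 then v = shift x y u
         else \<exists>\<phi>. u = fm_code \<phi> \<and> v = fm_code (rename x y \<phi>) \<and> wf_fm T \<phi>)"

lemma proof_meaning_simps:
  "proof_meaning A B (prod_encode (0, prod_encode (x, y))) \<longleftrightarrow> x < y"
  "proof_meaning A B (prod_encode (Suc 0, prod_encode (m, prod_encode (k, prod_encode (x, y))))) \<longleftrightarrow>
     y = shift m k x"
  "proof_meaning A B (prod_encode (2, prod_encode (m, prod_encode (k, prod_encode (c, d))))) \<longleftrightarrow>
     (\<exists>\<phi>. c = fm_code \<phi> \<and> d = fm_code (rename m k \<phi>) \<and> wf_fm (literal_theory A B) \<phi>)"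
  "proof_meaning A B (prod_encode (3, prod_encode (k, c))) \<longleftrightarrow>
     (\<exists>\<phi>. c = fm_code \<phi> \<and> wf_fm (literal_theory A B) \<phi> \<and> fv \<phi> \<subseteq> {..<k})"
  "proof_meaning A B (prod_encode (4, c)) \<longleftrightarrow> (\<exists>\<phi>. c = fm_code \<phi> \<and> provable (literal_theory A B) \<phi>)"
  "proof_meaning A B (prod_encode (5, c)) \<longleftrightarrow> c \<in> fm_code ` axs (literal_theory A B)"
  "proof_meaning A B (prod_encode (6, c)) \<longleftrightarrow> c \<in> provable_codes (literal_theory A B)"
  "proof_meaning A B (prod_encode (7, c)) \<longleftrightarrow> c \<in> refutable_codes (literal_theory A B)"
  "proof_meaning A B (prod_encode (8, n)) \<longleftrightarrow> n \<in> A"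
  "proof_meaning A B (prod_encode (9, n)) \<longleftrightarrow> n \<in> B"
  unfolding proof_meaning_def by auto

definition literals :: "nat set \<Rightarrow> nat set \<Rightarrow> nat set" where
  "literals A B = {prod_encode (8, n) | n. n \<in> A} \<union> {prod_encode (9, n) | n. n \<in> B}"

abbreviation proof_derivable :: "nat set \<Rightarrow> nat set \<Rightarrow> nat \<Rightarrow> bool" where
  "proof_derivable A B \<equiv> derives proof_clauses (literals A B)"

lemma proof_clauses_sound:
  assumes "proof_derivable A B z"
  shows "proof_meaning A B z"
  using assms
proof (rule derives_sound)
  show "proof_meaning A B z" if "z \<in> literals A B" for z
    using that unfolding literals_def by (auto simp: proof_meaning_simps)
  have pos: "provable (literal_theory A B) (Rel n [])" if "n \<in> A" for n
    using that by (auto intro: Ax)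
  have neg: "provable (literal_theory A B) (Neg (Rel n []))" if "n \<in> B" for n
    using that by (auto intro: Ax)
  have bound: "fv \<phi> \<subseteq> {..<Suc k} \<Longrightarrow> Suc x \<in> fv \<phi> \<Longrightarrow> x < k" for \<phi> k x by auto
  \<comment> \<open>As all terms are variables, the axioms with \<open>inst\<close> and
    \<open>lift\<close> are restated through \<open>rename\<close>, the form in which the clauses
    express them.\<close>
  note inst = Ax_inst[where T = "literal_theory A B" and t = "Var y" for y,
      unfolded inst_eq_rename, simplified]
  note all = Ax_all[where T = "literal_theory A B", unfolded lift_eq_rename, simplified]
  note leibniz = Ax_Leibniz[where T = "literal_theory A B" and s = "Var y" and t = "Var z" for y z,
      unfolded inst_eq_rename, simplified]
  show "\<forall>(ps, c)\<in>set proof_clauses. \<forall>e.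
      (\<forall>p\<in>set ps. proof_meaning A B (pat_value e p)) \<longrightarrow> proof_meaning A B (pat_value e c)"
    unfolding proof_clauses_def
    by (auto simp: proof_meaning_simps node_eq_fm_code_iff eq_tm_code_Var_iff
        rename_Forall[symmetric] provable_codes_def refutable_codes_def is_sentence_def
        simp del: fm_code.simps
        intro: pos neg inst all leibniz provable.intros dest: bound)
qed

section \<open>Completeness of the program for provability\<close>

lemma proof_clauses_less: "x < y \<Longrightarrow> proof_derivable A B (prod_encode (0, prod_encode (x, y)))"
proof (induction x arbitrary: y)
  case 0
  then show ?case using derives_nth[of 0 proof_clauses _ "nth [y - 1]"]
    by (simp add: proof_clauses_def)
next
  case (Suc x)
  then show ?case using derives_nth[of 1 proof_clauses _ "nth [x, y - 1]"] Suc.IH[of "y - 1"]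
    by (simp add: proof_clauses_def)
qed

lemma proof_clauses_shift:
  "proof_derivable A B (prod_encode (1, prod_encode (m, prod_encode (k, prod_encode (x, shift m k x)))))"
proof (induction m k x rule: shift.induct)
  case (1 m k)
  show ?case using derives_nth[of 2 proof_clauses _ "nth [m, k]"]
    by (simp add: proof_clauses_def)
next
  case (2 m k x)
  then show ?case using derives_nth[of 3 proof_clauses _ "nth [m, k, x, shift m k x]"]
    by (simp add: proof_clauses_def)
next
  case (3 x)
  show ?case using derives_nth[of 4 proof_clauses _ "nth [x]"]
    by (simp add: proof_clauses_def)
next
  case (4 y)
  show ?case using derives_nth[of 5 proof_clauses _ "nth [y]"]
    by (simp add: proof_clauses_def)
next
  case (5 y x)
  show ?case using derives_nth[of 6 proof_clauses _ "nth [y, x]"]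
    by (simp add: proof_clauses_def)
qed

lemma proof_clauses_rename:
  "wf_fm (literal_theory A B) \<phi> \<Longrightarrow>
   proof_derivable A B (prod_encode (2, prod_encode (m, prod_encode (k, prod_encode (fm_code \<phi>, fm_code (rename m k \<phi>))))))"
proof (induction \<phi> arbitrary: k)
  case Fls
  show ?case using derives_nth[of 7 proof_clauses _ "nth [m, k]"]
    by (simp add: proof_clauses_def)
next
  case (Eq s t)
  then obtain x y where [simp]: "s = Var x" "t = Var y" by auto
  show ?case
    using derives_nth[of 8 proof_clauses _ "nth [m, k, x, shift m k x, y, shift m k y]"]
      proof_clauses_shift[of A B m k x] proof_clauses_shift[of A B m k y]
    by (simp add: proof_clauses_def)
next
  case (Rel r ts)
  then show ?case using derives_nth[of 9 proof_clauses _ "nth [m, k, r]"]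
    by (simp add: proof_clauses_def)
next
  case (Imp \<phi> \<psi>)
  then show ?case
    using derives_nth[of 10 proof_clauses _ "nth [m, k, fm_code \<phi>, fm_code (rename m k \<phi>),
        fm_code \<psi>, fm_code (rename m k \<psi>)]"]
    by (simp add: proof_clauses_def)
next
  case (Forall \<phi>)
  then show ?case
    using derives_nth[of 11 proof_clauses _ "nth [m, k, fm_code \<phi>, fm_code (rename m (Suc k) \<phi>)]"]
    by (simp add: proof_clauses_def rename_Forall del: subst.simps)
qed

lemma proof_clauses_wf:
  "wf_fm (literal_theory A B) \<phi> \<Longrightarrow> fv \<phi> \<subseteq> {..<k} \<Longrightarrow>
   proof_derivable A B (prod_encode (3, prod_encode (k, fm_code \<phi>)))"
proof (induction \<phi> arbitrary: k)
  case Fls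
  show ?case using derives_nth[of 12 proof_clauses _ "nth [k]"]
    by (simp add: proof_clauses_def)
next
  case (Eq s t)
  then obtain x y where [simp]: "s = Var x" "t = Var y" by auto
  from Eq show ?case
    using derives_nth[of 13 proof_clauses _ "nth [k, x, y]"] proof_clauses_less[of x k A B]
      proof_clauses_less[of y k A B]
    by (simp add: proof_clauses_def)
next
  case (Rel r ts)
  then show ?case using derives_nth[of 14 proof_clauses _ "nth [k, r]"]
    by (simp add: proof_clauses_def)
next
  case (Imp \<phi> \<psi>)
  then show ?case
    using derives_nth[of 15 proof_clauses _ "nth [k, fm_code \<phi>, fm_code \<psi>]"]
    by (simp add: proof_clauses_def)
next
  case (Forall \<phi>)
  have "fv \<phi> \<subseteq> {..<Suc k}"
  proof
    fix x
    assume "x \<in> fv \<phi>"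
    then show "x \<in> {..<Suc k}" using Forall.prems(2) by (cases x) auto
  qed
  with Forall show ?case
    using derives_nth[of 16 proof_clauses _ "nth [k, fm_code \<phi>]"]
    by (simp add: proof_clauses_def)
qed

lemma finite_fv_tm: "finite (fv_tm t)"
  by (induction t) auto

lemma finite_fv: "finite (fv \<phi>)"
proof (induction \<phi>)
  case (Forall \<phi>)
  then have "finite (Suc -` fv \<phi>)" by (simp add: finite_vimageI)
  then show ?case by (simp add: vimage_def)
qed (auto simp: finite_fv_tm)

text \<open>A formula has finitely many free variables, so some bound exists; the clauses for the
  logical axioms accept any.\<close>

lemma ex_proof_clauses_wf:
  assumes "wf_fm (literal_theory A B) \<phi>"
  obtains k where "proof_derivable A B (prod_encode (3, prod_encode (k, fm_code \<phi>)))"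
  using proof_clauses_wf[OF assms] finite_fv[of \<phi>] by (metis finite_nat_set_iff_bounded lessThan_iff subsetI)

lemma proof_clauses_axiom:
  assumes "\<phi> \<in> axs (literal_theory A B)"
  shows "proof_derivable A B (prod_encode (5, fm_code \<phi>))"
proof -
  consider n where "n \<in> A" "\<phi> = Rel n []" | n where "n \<in> B" "\<phi> = Neg (Rel n [])"
    using assms by auto
  then show ?thesis
  proof cases
    case 1
    then have "proof_derivable A B (prod_encode (8, n))"
      by (intro base) (simp add: literals_def)
    with 1 show ?thesis
      using derives_nth[of 17 proof_clauses _ "nth [n]"] by (simp add: proof_clauses_def)
  next
    case 2
    then have "proof_derivable A B (prod_encode (9, n))"
      by (intro base) (simp add: literals_def)
    with 2 show ?thesis
      using derives_nth[of 18 proof_clauses _ "nth [n]"] by (simp add: proof_clauses_def)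
  qed
qed

lemma proof_clauses_provable:
  "provable (literal_theory A B) \<phi> \<Longrightarrow> proof_derivable A B (prod_encode (4, fm_code \<phi>))"
proof (induction rule: provable.induct)
  case (Ax \<phi>)
  from proof_clauses_axiom[OF this] show ?case
    using derives_nth[of 19 proof_clauses _ "nth [fm_code \<phi>]"] by (simp add: proof_clauses_def)
next
  case (Ax_K \<phi> \<psi>)
  from Ax_K(1) obtain k where "proof_derivable A B (prod_encode (3, prod_encode (k, fm_code \<phi>)))"
    by (rule ex_proof_clauses_wf)
  moreover from Ax_K(2) obtain l where "proof_derivable A B (prod_encode (3, prod_encode (l, fm_code \<psi>)))"
    by (rule ex_proof_clauses_wf)
  ultimately show ?case
    using derives_nth[of 20 proof_clauses _ "nth [k, fm_code \<phi>, l, fm_code \<psi>]"]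
    by (simp add: proof_clauses_def)
next
  case (Ax_S \<phi> \<psi> \<chi>)
  from Ax_S(1) obtain k where "proof_derivable A B (prod_encode (3, prod_encode (k, fm_code \<phi>)))"
    by (rule ex_proof_clauses_wf)
  moreover from Ax_S(2) obtain l where "proof_derivable A B (prod_encode (3, prod_encode (l, fm_code \<psi>)))"
    by (rule ex_proof_clauses_wf)
  moreover from Ax_S(3) obtain m where "proof_derivable A B (prod_encode (3, prod_encode (m, fm_code \<chi>)))"
    by (rule ex_proof_clauses_wf)
  ultimately show ?case
    using derives_nth[of 21 proof_clauses _ "nth [k, fm_code \<phi>, l, fm_code \<psi>, m, fm_code \<chi>]"]
    by (simp add: proof_clauses_def)
next
  case (Ax_DN \<phi>)
  then obtain k where "proof_derivable A B (prod_encode (3, prod_encode (k, fm_code \<phi>)))"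
    by (rule ex_proof_clauses_wf)
  then show ?case
    using derives_nth[of 22 proof_clauses _ "nth [k, fm_code \<phi>]"]
    by (simp add: proof_clauses_def)
next
  case (Ax_inst \<phi> t)
  then obtain y where [simp]: "t = Var y" by auto
  from Ax_inst show ?case
    using derives_nth[of 23 proof_clauses _ "nth [y, fm_code \<phi>, fm_code (inst t \<phi>)]"]
      proof_clauses_rename[of A B \<phi> "Suc y" 0]
    by (simp add: proof_clauses_def inst_eq_rename)
next
  case (Ax_all \<phi> \<psi>)
  from Ax_all(2) obtain k where "proof_derivable A B (prod_encode (3, prod_encode (k, fm_code \<psi>)))"
    by (rule ex_proof_clauses_wf)
  with Ax_all(1) show ?case
    using derives_nth[of 24 proof_clauses _ "nth [fm_code \<phi>, fm_code (lift \<phi>), k, fm_code \<psi>]"]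
      proof_clauses_rename[of A B \<phi> 0 0]
    by (simp add: proof_clauses_def lift_eq_rename)
next
  case (Ax_refl t)
  then obtain y where [simp]: "t = Var y" by auto
  show ?case
    using derives_nth[of 25 proof_clauses _ "nth [y]"] by (simp add: proof_clauses_def)
next
  case (Ax_Leibniz \<phi> s t)
  then obtain y z where [simp]: "s = Var y" "t = Var z" by auto
  from Ax_Leibniz show ?case
    using derives_nth[of 26 proof_clauses _
        "nth [y, z, fm_code \<phi>, fm_code (inst s \<phi>), fm_code (inst t \<phi>)]"]
      proof_clauses_rename[of A B \<phi> "Suc y" 0] proof_clauses_rename[of A B \<phi> "Suc z" 0]
    by (simp add: proof_clauses_def inst_eq_rename)
next
  case (MP \<phi> \<psi>)
  then show ?case
    using derives_nth[of 27 proof_clauses _ "nth [fm_code \<phi>, fm_code \<psi>]"]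
    by (simp add: proof_clauses_def)
next
  case (Gen \<phi>)
  then show ?case
    using derives_nth[of 28 proof_clauses _ "nth [fm_code \<phi>]"] by (simp add: proof_clauses_def)
qed

section \<open>Axioms, theorems and refutable sentences as RE sets\<close>

lemma axiom_codes_iff:
  "c \<in> fm_code ` axs (literal_theory A B) \<longleftrightarrow> proof_derivable A B (prod_encode (5, c))"
  using proof_clauses_axiom proof_clauses_sound proof_meaning_simps(6) by blast

lemma provable_codes_iff:
  "c \<in> provable_codes (literal_theory A B) \<longleftrightarrow> proof_derivable A B (prod_encode (6, c))"
proof
  assume "c \<in> provable_codes (literal_theory A B)"
  then obtain \<phi> where "c = fm_code \<phi>" "is_sentence (literal_theory A B) \<phi>"
      "provable (literal_theory A B) \<phi>"
    unfolding provable_codes_def by blast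
  then show "proof_derivable A B (prod_encode (6, c))"
    using derives_nth[of 29 proof_clauses _ "nth [c]"] proof_clauses_provable[of A B \<phi>]
      proof_clauses_wf[of A B \<phi> 0]
    by (simp add: proof_clauses_def is_sentence_def)
next
  assume "proof_derivable A B (prod_encode (6, c))"
  then show "c \<in> provable_codes (literal_theory A B)"
    using proof_clauses_sound proof_meaning_simps(7) by blast
qed

lemma refutable_codes_iff:
  "c \<in> refutable_codes (literal_theory A B) \<longleftrightarrow> proof_derivable A B (prod_encode (7, c))"
proof
  assume "c \<in> refutable_codes (literal_theory A B)"
  then obtain \<phi> where "c = fm_code \<phi>" "is_sentence (literal_theory A B) \<phi>"
      "provable (literal_theory A B) (Neg \<phi>)"
    unfolding refutable_codes_def by blast
  then show "proof_derivable A B (prod_encode (7, c))"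
    using derives_nth[of 30 proof_clauses _ "nth [c]"] proof_clauses_provable[of A B "Neg \<phi>"]
      proof_clauses_wf[of A B \<phi> 0]
    by (simp add: proof_clauses_def is_sentence_def)
next
  assume "proof_derivable A B (prod_encode (7, c))"
  then show "c \<in> refutable_codes (literal_theory A B)"
    using proof_clauses_sound proof_meaning_simps(8) by blast
qed

lemma re_set_proof_derivable:
  assumes "semidecidable A" "semidecidable B"
  shows "re_set {c. proof_derivable A B (prod_encode (t, c))}"
proof -
  have "semidecidable (literals A B)"
    unfolding literals_def by (intro semidecidable_Un semidecidable_tagged assms)
  then have "semidecidable {c. prod_encode (t, c) \<in> {z. proof_derivable A B z}}"
    by (intro semidecidable_vimage semidecidable_derives recursive_pair recursive_const recursive_id)
  then show ?thesis by (intro semidecidable_imp_re_set) simp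
qed

lemma re_set_literal_theory:
  assumes "semidecidable A" "semidecidable B"
  shows "re_set (fm_code ` axs (literal_theory A B))"
    and "re_set (provable_codes (literal_theory A B))"
    and "re_set (refutable_codes (literal_theory A B))"
  using re_set_proof_derivable[OF assms, of 5] re_set_proof_derivable[OF assms, of 6]
    re_set_proof_derivable[OF assms, of 7]
  by (simp_all only: axiom_codes_iff[symmetric] provable_codes_iff[symmetric]
      refutable_codes_iff[symmetric] Collect_mem_eq)

lemma re_theory_literal_theory:
  assumes "semidecidable A" "semidecidable B"
  shows "re_theory (literal_theory A B)"
proof -
  have "recursive_set {x. snd (prod_decode x) = 0}"
    by (intro recursive_set_eq recursive_snd recursive_id recursive_const)
  moreover have "{x. snd (prod_decode x) = 0} = prod_encode ` rels (literal_theory A B)"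
  proof -
    have "x \<in> prod_encode ` {(n, 0) | n. True}" if "snd (prod_decode x) = 0" for x
      using that by (intro image_eqI[of _ _ "prod_decode x"]) (auto simp: prod_eq_iff)
    then show ?thesis by auto
  qed
  moreover have "recursive_set (prod_encode ` funs (literal_theory A B))"
    using recursive_set_const[of False] by simp
  moreover have "\<forall>\<phi>\<in>axs (literal_theory A B). is_sentence (literal_theory A B) \<phi>"
    by (auto simp: is_sentence_def)
  ultimately show ?thesis
    unfolding re_theory_def using re_set_literal_theory(1)[OF assms] by metis
qed


subsection \<open>An effectively inseparable literal theory\<close>

text \<open>The set records which of two enumerations shows \<open>x\<close> first. The range up to
  \<open>Suc d\<close> includes stage \<open>d\<close> itself, so a tie is a win for neither side.
  Asymmetry therefore holds for all indices, even if \<open>W i\<close> and \<open>W j\<close>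
  overlap.\<close>

lemma ex_enumeration_race:
  obtains F where "semidecidable F"
    and "\<And>i j x. x \<in> W i \<Longrightarrow> x \<notin> W j \<Longrightarrow> prod_encode (prod_encode (i, j), x) \<in> F"
    and "\<And>i j x. prod_encode (prod_encode (i, j), x) \<in> F \<Longrightarrow> prod_encode (prod_encode (j, i), x) \<notin> F"
proof -
  obtain R where R: "recursive_set R"
    "\<And>i x. x \<in> W i \<longleftrightarrow> (\<exists>d. prod_encode (prod_encode (i, x), d) \<in> R)"
    using semidecidable_W unfolding semidecidable_def
    by (metis (mono_tags, lifting) fst_conv mem_Collect_eq prod_encode_inverse snd_conv)
  define stage where "stage i x d = prod_encode (prod_encode (i, x), d)" for i x d :: nat
  \<comment> \<open>\<open>x\<close> is seen to enter \<open>W i\<close> at stage \<open>d\<close>, and not seen to enter \<open>W j\<close> up to then\<close>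
  let ?Q = "\<lambda>i j x d. stage i x d \<in> R \<and> (\<forall>d'<Suc d. stage j x d' \<notin> R)"
  let ?S = "{y. ?Q (fst (prod_decode (fst (prod_decode (fst (prod_decode y))))))
     (snd (prod_decode (fst (prod_decode (fst (prod_decode y))))))
     (snd (prod_decode (fst (prod_decode y)))) (snd (prod_decode y))}"
  let ?F = "{y. \<exists>d. prod_encode (y, d) \<in> ?S}"
  have "recursive_set ?S"
    unfolding stage_def
    by (intro recursive_set_conj recursive_set_ball_less recursive_set_Not
        recursive_set_vimage[OF R(1)] recursive_pair recursive_Suc recursive_fst recursive_snd
        recursive_id)
  then have "semidecidable ?F" unfolding semidecidable_def by blast
  moreover have F: "prod_encode (prod_encode (i, j), x) \<in> ?F \<longleftrightarrow> (\<exists>d. ?Q i j x d)" for i j x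
    by simp
  moreover have "\<exists>d. ?Q i j x d" if "x \<in> W i" "x \<notin> W j" for i j x
    using that unfolding R(2) stage_def by blast
  moreover have "\<not> ((\<exists>d. ?Q i j x d) \<and> (\<exists>d. ?Q j i x d))" for i j x
    by (metis less_Suc_eq linorder_neqE_nat)
  ultimately show thesis using that[of ?F] unfolding F by blast
qed

text \<open>The race concerns codes of letters and arbitrary index pairs but never the theory under
  construction, so no fixed point is involved. The function witnessing inseparability merely writes
  down the letter numbered by the pair of indices.\<close>

theorem ex_effectively_inseparable_literal_theory:
  obtains A B where "A \<inter> B = {}" "semidecidable A" "semidecidable B" "EI_theory (literal_theory A B)"
proof -
  obtain F where F: "semidecidable F"
    "\<And>i j x. x \<in> W i \<Longrightarrow> x \<notin> W j \<Longrightarrow> prod_encode (prod_encode (i, j), x) \<in> F"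
    "\<And>i j x. prod_encode (prod_encode (i, j), x) \<in> F \<Longrightarrow> prod_encode (prod_encode (j, i), x) \<notin> F"
    using ex_enumeration_race by metis
  \<comment> \<open>For \<open>n\<close> coding the pair of \<open>i\<close> and \<open>j\<close>, a
    first appearance in \<open>W j\<close> puts \<open>n\<close> into \<open>A\<close>, and one in
    \<open>W i\<close> puts it into \<open>B\<close>. The axiom contradicts the side that showed the
    letter first: a letter in \<open>W i\<close> alone becomes refutable and is thus forced into
    \<open>W j\<close>, and symmetrically.\<close>
  define A where "A = {n. prod_encode (prod_encode (snd (prod_decode n), fst (prod_decode n)), fm_code (Rel n [])) \<in> F}"
  define B where "B = {n. prod_encode (prod_encode (fst (prod_decode n), snd (prod_decode n)), fm_code (Rel n [])) \<in> F}"
  let ?T = "literal_theory A B"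
  have code: "recursive (\<lambda>n. fm_code (Rel n []))"
    by (simp, intro recursive_pair recursive_const recursive_id)
  have disj: "A \<inter> B = {}" unfolding A_def B_def using F(3) by blast
  have semi: "semidecidable A" "semidecidable B"
    unfolding A_def B_def
    by (intro semidecidable_vimage[OF F(1)] recursive_pair recursive_fst recursive_snd recursive_id code)+
  let ?f = "\<lambda>i j. fm_code (Rel (prod_encode (i, j)) [])"
  have "recursive2 ?f" using code unfolding recursive_def recursive2_def by blast
  moreover have "?f i j \<notin> W i \<union> W j"
    if sub: "provable_codes ?T \<subseteq> W i" "refutable_codes ?T \<subseteq> W j" and "W i \<inter> W j = {}" for i j
  proof
    let ?n = "prod_encode (i, j)"
    have sentence: "is_sentence ?T (Rel ?n [])" by (simp add: is_sentence_def)
    assume "?f i j \<in> W i \<union> W j"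
    then consider "?f i j \<in> W i" "?f i j \<notin> W j" | "?f i j \<in> W j" "?f i j \<notin> W i"
      using \<open>W i \<inter> W j = {}\<close> by blast
    then show False
    proof cases
      case 1
      then have "?n \<in> B" using F(2) unfolding B_def by simp
      then have "provable ?T (Neg (Rel ?n []))" by (auto intro: Ax)
      then have "?f i j \<in> refutable_codes ?T" unfolding refutable_codes_def using sentence by blast
      then show False using sub 1 by blast
    next
      case 2
      then have "?n \<in> A" using F(2) unfolding A_def by simp
      then have "provable ?T (Rel ?n [])" by (auto intro: Ax)
      then have "?f i j \<in> provable_codes ?T" unfolding provable_codes_def using sentence by blast
      then show False using sub 2 by blast
    qed
  qed
  moreover have "provable_codes ?T \<inter> refutable_codes ?T = {}"
    proof -
    have False if "provable ?T \<phi>" "provable ?T (Neg \<phi>)" for \<phi>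
      using sat_literal_theory[OF disj MP[OF that(2,1)]] by simp
    then show ?thesis unfolding provable_codes_def refutable_codes_def by auto
  qed
  ultimately have "EI_theory ?T"
    unfolding EI_theory_def effectively_inseparable_def
    using re_set_literal_theory[OF semi] by blast
  then show thesis using that disj semi by blast
qed

theorem theorem3p10:
  shows "(\<forall>n\<ge>1. \<exists>T. consistent T \<and> re_theory T \<and> EI_theory T \<and> \<not> n_Rosser n T) \<and>
         \<not> (\<forall>T. consistent T \<longrightarrow> re_theory T \<longrightarrow> EI_theory T \<longrightarrow> Rosser T)"
proof -
  obtain A B where AB: "A \<inter> B = {}" "semidecidable A" "semidecidable B" "EI_theory (literal_theory A B)"
    by (rule ex_effectively_inseparable_literal_theory)
  let ?T = "literal_theory A B"
  have "consistent ?T" unfolding consistent_def using sat_literal_theory[OF AB(1), of Fls] by auto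
  moreover have "re_theory ?T" using AB(2,3) by (rule re_theory_literal_theory)
  \<comment> \<open>One theory serves every \<open>n\<close>, because already an interpretation of
    Num is missing; it also refutes the general implication to \<open>Rosser\<close>.\<close>
  moreover have "\<not> n_Rosser n ?T" for n
  proof -
    have "sat (\<lambda>n. n \<in> A) \<psi>" if "\<psi> \<in> axs ?T" for \<psi>
      using sat_literal_theory[OF AB(1)] that by (blast intro: Ax)
    then show ?thesis unfolding n_Rosser_def using not_interpretation_of_Num by blast
  qed
  ultimately show ?thesis using AB(4) unfolding Rosser_def by blast
qed

end
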